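(* Let $M$ be a segment Halin graph with $m(M)$ segments, $p(M)$ intersection points and $c(M)$ circuits. Then \[p(M)\geq\left\lceil\frac{m(M)+2}{2}\right\rceil,\qquad c(M)\geq\left\lceil\frac{m(M)+3}{3}\right\rceil,\] and these bounds are tight.
   Context: $M$ is a finite set of line segments of nonzero length in the plane; collinear intersecting segments are treated as a single segment. $P(M)$ is the set of points lying on at least two segments of $M$ (intersection points), $J(M)$ the set of segment endpoints. $G_M$ is the graph with vertex set $P(M)\cup J(M)$, where $u,v$ are adjacent iff some segment $s\in M$ contains both and no point of $P(M)\cup J(M)$ lies on $s$ strictly between them; $G_M$ is embedded in the plane as drawn by $M$. Circuits of $M$ are the bounded faces of $G_M$. $m(M)=|M|$, $p(M)=|P(M)|$, $c(M)$ is the number of circuits. A Halin graph is a graph obtained from a plane tree with no vertices of degree two (and at least one non-leaf) by joining its leaves in a cycle in their clockwise order given by the embedding. $M$ is a segment Halin graph if $G_M$ is a Halin graph and, in the embedding of $G_M$ induced by $M$, the edges of the outer face are exactly the edges of the cycle used in this construction. "Tight" means there exist segment Halin graphs (for infinitely many values of $m$) for which each bound holds with equality. *)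

theory Defs
  imports "HOL-Analysis.Analysis" "HOL-Combinatorics.Orbits"
begin

definition simple_graph :: "'a set \<Rightarrow> 'a set set \<Rightarrow> bool" where
  "simple_graph V E \<longleftrightarrow>
     finite V \<and> (\<forall>e\<in>E. \<exists>u\<in>V. \<exists>v\<in>V. u \<noteq> v \<and> e = {u, v})"

definition neighbours :: "'a set set \<Rightarrow> 'a \<Rightarrow> 'a set" where
  "neighbours E v = {w. {v, w} \<in> E}"

definition vdegree :: "'a set set \<Rightarrow> 'a \<Rightarrow> nat" where
  "vdegree E v = card (neighbours E v)"

definition connected_graph :: "'a set \<Rightarrow> 'a set set \<Rightarrow> bool" where
  "connected_graph V E \<longleftrightarrow>
     V \<noteq> {} \<and> (\<forall>u\<in>V. \<forall>v\<in>V. (u, v) \<in> {(x, y). {x, y} \<in> E}\<^sup>*)"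

definition cycle_edges :: "'a list \<Rightarrow> 'a set set" where
  "cycle_edges xs = {{xs ! i, xs ! (Suc i mod length xs)} | i. i < length xs}"

definition acyclic_graph :: "'a set set \<Rightarrow> bool" where
  "acyclic_graph E \<longleftrightarrow>
     \<not> (\<exists>xs. distinct xs \<and> 3 \<le> length xs \<and> cycle_edges xs \<subseteq> E)"

definition tree_graph :: "'a set \<Rightarrow> 'a set set \<Rightarrow> bool" where
  "tree_graph V E \<longleftrightarrow> simple_graph V E \<and> connected_graph V E \<and> acyclic_graph E"

definition leaves :: "'a set \<Rightarrow> 'a set set \<Rightarrow> 'a set" where
  "leaves V E = {v \<in> V. vdegree E v = 1}"

text \<open>
  The embedding of a plane tree is given by its rotation system: \<open>rot v u\<close> is the neighbour
  of \<open>v\<close> that follows the neighbour \<open>u\<close> in the clockwise order around \<open>v\<close>. As \<open>cyclic_on\<close> requires a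
  nonempty set, the one-vertex tree is excluded.
\<close>

definition plane_tree :: "'a set \<Rightarrow> 'a set set \<Rightarrow> ('a \<Rightarrow> 'a \<Rightarrow> 'a) \<Rightarrow> bool" where
  "plane_tree V T rot \<longleftrightarrow>
     tree_graph V T \<and> (\<forall>v\<in>V. cyclic_on (rot v) (neighbours T v))"

text \<open>
  \<open>contour T rot l u v\<close>: the walk around the tree that starts at \<open>l\<close> traverses the edge from
  \<open>u\<close> to \<open>v\<close> before or when it reaches the first leaf after \<open>l\<close>. Having arrived at \<open>v\<close> from \<open>u\<close>,
  the walk leaves \<open>v\<close> along the edge following \<open>{v, u}\<close> clockwise around \<open>v\<close>; it thus keeps the
  tree on its right and goes around it clockwise.
\<close>

inductive contour :: "'a set set \<Rightarrow> ('a \<Rightarrow> 'a \<Rightarrow> 'a) \<Rightarrow> 'a \<Rightarrow> 'a \<Rightarrow> 'a \<Rightarrow> bool"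
  for T rot l where
  start: "{l, x} \<in> T \<Longrightarrow> contour T rot l l x"
| turn: "contour T rot l u v \<Longrightarrow> vdegree T v \<noteq> 1 \<Longrightarrow> contour T rot l v (rot v u)"

definition next_leaf ::
    "'a set \<Rightarrow> 'a set set \<Rightarrow> ('a \<Rightarrow> 'a \<Rightarrow> 'a) \<Rightarrow> 'a \<Rightarrow> 'a \<Rightarrow> bool" where
  "next_leaf V T rot l l' \<longleftrightarrow>
     l \<in> leaves V T \<and> l' \<in> leaves V T \<and> (\<exists>u. contour T rot l u l')"

definition clockwise_leaves ::
    "'a set \<Rightarrow> 'a set set \<Rightarrow> ('a \<Rightarrow> 'a \<Rightarrow> 'a) \<Rightarrow> 'a list \<Rightarrow> bool" where
  "clockwise_leaves V T rot ls \<longleftrightarrow>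
     distinct ls \<and> set ls = leaves V T \<and>
     (\<forall>i<length ls. next_leaf V T rot (ls ! i) (ls ! (Suc i mod length ls)))"

text \<open>\<open>(V, E)\<close> is a Halin graph, and \<open>C\<close> is the set of edges of the cycle added to the tree.\<close>

definition halin_graph_with_cycle :: "'a set \<Rightarrow> 'a set set \<Rightarrow> 'a set set \<Rightarrow> bool" where
  "halin_graph_with_cycle V E C \<longleftrightarrow>
     (\<exists>T rot ls. plane_tree V T rot
        \<and> (\<forall>v\<in>V. vdegree T v \<noteq> 2)
        \<and> (\<exists>v\<in>V. v \<notin> leaves V T)
        \<and> clockwise_leaves V T rot ls
        \<and> C = cycle_edges ls
        \<and> E = T \<union> C)"

text \<open>
  Collinear intersecting segments count as one segment, so distinct collinear members
  of the set are required to be disjoint.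
\<close>

definition segment_set :: "complex set set \<Rightarrow> bool" where
  "segment_set M \<longleftrightarrow>
     finite M
     \<and> (\<forall>s\<in>M. \<exists>a b. a \<noteq> b \<and> s = closed_segment a b)
     \<and> (\<forall>s\<in>M. \<forall>t\<in>M. s \<noteq> t \<and> collinear (s \<union> t) \<longrightarrow> s \<inter> t = {})"

definition intersection_points :: "complex set set \<Rightarrow> complex set" where
  "intersection_points M = {x. \<exists>s\<in>M. \<exists>t\<in>M. s \<noteq> t \<and> x \<in> s \<and> x \<in> t}"

definition segment_endpoints :: "complex set set \<Rightarrow> complex set" where
  "segment_endpoints M = {a. \<exists>b. closed_segment a b \<in> M}"

definition graph_vertices :: "complex set set \<Rightarrow> complex set" where
  "graph_vertices M = intersection_points M \<union> segment_endpoints M"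

definition graph_edges :: "complex set set \<Rightarrow> complex set set" where
  "graph_edges M =
     {{u, v} | u v. u \<in> graph_vertices M \<and> v \<in> graph_vertices M \<and> u \<noteq> v
        \<and> (\<exists>s\<in>M. u \<in> s \<and> v \<in> s \<and> graph_vertices M \<inter> open_segment u v = {})}"

text \<open>The drawing of the graph is the union of the segments; its faces are the components of
  the complement.\<close>

definition circuits :: "complex set set \<Rightarrow> complex set set" where
  "circuits M = {F \<in> components (- \<Union>M). bounded F}"

definition outer_face_edges :: "complex set set \<Rightarrow> complex set set" where
  "outer_face_edges M =
     {{u, v} | u v. {u, v} \<in> graph_edges M
        \<and> closed_segment u v \<subseteq> frontier (outside (\<Union>M))}"

definition segment_halin_graph :: "complex set set \<Rightarrow> bool" where
  "segment_halin_graph M \<longleftrightarrow>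
     segment_set M
     \<and> (\<exists>C. halin_graph_with_cycle (graph_vertices M) (graph_edges M) C
            \<and> outer_face_edges M = C)"

end

theory Submission
  imports Defs
begin

text \<open>
  Let the tree have \<open>n\<close> vertices, \<open>l\<close> of them leaves. Then \<open>G\<^sub>M\<close> has \<open>n - 1 + l\<close> edges, and the
  segments number at most that many, since each contains an edge that lies in no other segment.
  All degrees of \<open>G\<^sub>M\<close> are at least two, so every vertex is an intersection point, and \<open>l \<le> n - 1\<close>
  gives the first bound. Euler's formula shows that there are exactly \<open>l\<close> circuits, and counting
  degrees in the tree gives \<open>n \<le> 2 l - 2\<close>, whence the second bound.

  Euler's formula is obtained by drawing the graph edge by edge: first a spanning tree, each of whose
  edges has a free end and leaves the number of faces unchanged, then the other edges, each of
  which closes a Jordan curve and so separates its two sides.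

  Both bounds are attained by graphs whose outer cycle is a polygon inscribed in a parabola:
  the first by wheels, the second by cubic caterpillars.
\<close>

section \<open>Adding a segment to a closed set in the plane\<close>

text \<open>Counting faces is a local matter. When a segment is added to a closed set, only the
  component that contains its interior changes: it is replaced by the component \<open>L\<close>
  touching the segment from the left and the component \<open>R\<close> touching it from the right.
  All other components survive, so the only question is whether \<open>L = R\<close>.

  Sharpness needs two things. Every edge must be a segment of its own, so no two edges at a vertex
  may be collinear. The tree must also be extremal: \<open>2 * p = m + 2\<close> forces
  \<open>l = n - 1\<close>, a single inner vertex, and \<open>3 * c = m + 3\<close> forces
  \<open>n = 2 * l - 2\<close>, all inner vertices of degree three.

  The parabola turns convexity into integer arithmetic. The line through its points at
  \<open>j\<close> and \<open>j + 1\<close> lies below the point at \<open>x\<close> by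
  \<open>(x - j) * (x - j - 1)\<close>, which is positive at every other integer. Each side
  therefore supports the polygon, and only the tree edges need individual geometric checks.\<close>

definition left_side :: "complex \<Rightarrow> complex \<Rightarrow> complex set" where
  "left_side a b = {z. inner (\<i> * (b - a)) z > inner (\<i> * (b - a)) a}"

text \<open>\<open>\<i> * (b - a)\<close> is \<open>b - a\<close> after a quarter turn, hence normal
  to the line. Its inner product agrees at \<open>a\<close> and \<open>b\<close>, so reversing the
  segment only reverses the inequality, and results on the left side also serve the right.\<close>

lemma left_side_commute:
  "left_side b a = {z. inner (\<i> * (b - a)) z < inner (\<i> * (b - a)) a}"
  by (auto simp: left_side_def inner_complex_def algebra_simps)

lemma convex_left_side: "convex (left_side a b)"
  unfolding left_side_def by (rule convex_halfspace_gt)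

lemma inner_normal_segment:
  assumes "z \<in> closed_segment a b"
  shows "inner (\<i> * (b - a)) z = inner (\<i> * (b - a)) a"
proof -
  from assms obtain u where u: "z = (1 - u) *\<^sub>R a + u *\<^sub>R b" by (auto simp: in_segment)
  show ?thesis unfolding u by (simp add: inner_complex_def algebra_simps)
qed

lemma inner_normal_simps [simp]:
  fixes d :: complex
  shows "inner (\<i> * d) d = 0" "inner d (\<i> * d) = 0" "inner (\<i> * d) (\<i> * d) = (norm d)\<^sup>2"
  by (simp_all add: inner_complex_def cmod_power2) (simp add: power2_eq_square)

lemma left_side_segment_disjoint: "left_side a b \<inter> closed_segment a b = {}"
proof -
  have "z \<notin> left_side a b" if "z \<in> closed_segment a b" for z
    using inner_normal_segment[OF that] by (simp add: left_side_def)
  then show ?thesis by blast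
qed

lemma ball_left_side_nonempty:
  assumes "x \<in> closed_segment a b" "a \<noteq> b" "e > 0"
  shows "ball x e \<inter> left_side a b \<noteq> {}"
proof -
  define d where "d = e / (2 * norm (b - a))"
  define z where "z = x + d *\<^sub>R (\<i> * (b - a))"
  have "d > 0" using assms by (simp add: d_def)
  have "inner (\<i> * (b - a)) z = inner (\<i> * (b - a)) a + d * (norm (b - a))\<^sup>2"
    using inner_normal_segment[OF assms(1)] by (simp add: z_def inner_add_right)
  moreover have "d * (norm (b - a))\<^sup>2 > 0" using \<open>d > 0\<close> assms(2) by simp
  ultimately have "z \<in> left_side a b" by (simp add: left_side_def)
  moreover have "dist x z < e"
    using assms by (simp add: z_def dist_norm d_def norm_mult)
  ultimately show ?thesis by auto
qed

lemma line_if_not_left_or_right: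
  assumes "a \<noteq> b" "z \<notin> left_side a b" "z \<notin> left_side b a"
  obtains t where "z = a + t *\<^sub>R (b - a)"
proof -
  have eq: "inner (\<i> * (b - a)) z = inner (\<i> * (b - a)) a"
    using assms by (auto simp: left_side_commute[of b a]) (auto simp: left_side_def)
  \<comment> \<open>Up to the factor \<open>(norm (b - a))\<^sup>2\<close> this imaginary part is
    the normal functional at \<open>z - a\<close>. Its vanishing makes the quotient real, and the
    quotient is the parameter along the line.\<close>
  have "Im ((z - a) / (b - a)) = 0"
    using eq by (simp add: Im_divide inner_complex_def algebra_simps)
  then have "(z - a) / (b - a) = of_real (Re ((z - a) / (b - a)))"
    by (simp add: complex_eq_iff)
  then have "z = a + Re ((z - a) / (b - a)) *\<^sub>R (b - a)"
    using assms(1) by (simp add: scaleR_conv_of_real field_simps)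
  then show ?thesis using that by blast
qed

section \<open>Neighbourhoods of a segment and the components beside it\<close>

lemma ball_subset_sides_Un_segment:
  assumes "x \<in> open_segment a b"
  obtains e where "e > 0" "ball x e \<subseteq> left_side a b \<union> left_side b a \<union> open_segment a b"
proof -
  from assms obtain u where u: "a \<noteq> b" "0 < u" "u < 1" "x = (1 - u) *\<^sub>R a + u *\<^sub>R b"
    by (auto simp: in_segment)
  have xu: "x = a + u *\<^sub>R (b - a)" using u by (simp add: algebra_simps)
  \<comment> \<open>The distance from \<open>x\<close> to the nearer end, so that the ball meets the
    line only inside the open segment.\<close>
  define e where "e = min u (1 - u) * norm (b - a)"
  have "e > 0" using u by (simp add: e_def)
  moreover have "z \<in> open_segment a b"
    if z: "z \<in> ball x e" "z \<notin> left_side a b" "z \<notin> left_side b a" for z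
  proof -
    obtain t where t: "z = a + t *\<^sub>R (b - a)" using line_if_not_left_or_right[OF u(1) z(2,3)] .
    have "dist x z = \<bar>u - t\<bar> * norm (b - a)"
      by (simp add: t xu dist_norm scaleR_diff_left[symmetric])
    then have "\<bar>u - t\<bar> < min u (1 - u)" using z(1) u(1) by (simp add: e_def)
    then have "0 < t" "t < 1" by linarith+
    then show ?thesis using u(1) t by (auto simp: in_segment algebra_simps intro!: exI[of _ t])
  qed
  ultimately show ?thesis using that by blast
qed

text \<open>The compact part from \<open>x\<close> to \<open>y\<close> has positive distance
  \<open>e\<close> from \<open>K\<close>. The left half of its \<open>e\<close>-neighbourhood avoids
  \<open>K\<close> and is convex, being a Minkowski sum of convex sets cut by a half plane.\<close>

lemma connected_strip_along_segment:
  assumes "closed K" "K \<inter> open_segment a b = {}" "x \<in> open_segment a b" "y \<in> open_segment a b"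
  obtains N e where "e > 0" "connected N" "N \<inter> (K \<union> closed_segment a b) = {}"
    "ball x e \<inter> left_side a b \<subseteq> N" "ball y e \<inter> left_side a b \<subseteq> N"
proof -
  have "closed_segment x y \<subseteq> open_segment a b"
    using assms(3,4) by (simp add: closed_segment_subset)
  then have "closed_segment x y \<inter> K = {}" using assms(2) by blast
  then obtain e where e: "e > 0" "\<And>p q. p \<in> closed_segment x y \<Longrightarrow> q \<in> K \<Longrightarrow> e \<le> dist p q"
    using separate_compact_closed[of "closed_segment x y" K] assms(1) by auto
  define N where "N = {p + v | p v. p \<in> closed_segment x y \<and> v \<in> ball 0 e} \<inter> left_side a b"
  have "{p + v | p v. p \<in> closed_segment x y \<and> v \<in> ball 0 e}
      = (\<Union>p\<in>closed_segment x y. \<Union>v\<in>ball 0 e. {p + v})" by blast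
  then have "convex {p + v | p v. p \<in> closed_segment x y \<and> v \<in> ball 0 e}"
    using convex_sums[of "closed_segment x y" "ball 0 e"] by simp
  then have "connected N"
    unfolding N_def by (intro convex_connected convex_Int convex_left_side)
  moreover have "N \<inter> K = {}"
  proof -
    have "z \<notin> K" if "p \<in> closed_segment x y" "v \<in> ball 0 e" "z = p + v" for z p v
      using e(2)[OF that(1), of z] that(2,3) by (auto simp: dist_norm)
    then show ?thesis by (auto simp: N_def)
  qed
  moreover have "N \<inter> closed_segment a b = {}"
    using left_side_segment_disjoint by (auto simp: N_def)
  moreover have "ball p e \<inter> left_side a b \<subseteq> N" if "p \<in> closed_segment x y" for p
  proof
    fix z assume z: "z \<in> ball p e \<inter> left_side a b"
    then have "z = p + (z - p)" "z - p \<in> ball 0 e" by (auto simp: dist_norm norm_minus_commute)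
    then show "z \<in> N" using that z unfolding N_def by blast
  qed
  ultimately show ?thesis using that[OF e(1), of N] by blast
qed

text \<open>A strip joins the midpoint to any other interior point, and all these strips share a
  small half disc at the midpoint, so they lie in one component. The radius depends on
  \<open>x\<close> because \<open>K\<close> may touch the segment at its ends.\<close>

lemma side_component:
  assumes "closed K" "a \<noteq> b" "K \<inter> open_segment a b = {}"
  obtains L where "L \<in> components (- (K \<union> closed_segment a b))"
    "\<And>x. x \<in> open_segment a b \<Longrightarrow> \<exists>e>0. ball x e \<inter> left_side a b \<subseteq> L"
proof -
  let ?p = "midpoint a b"
  have p: "?p \<in> open_segment a b" using assms(2) by simp
  obtain N e where N: "e > 0" "connected N" "N \<inter> (K \<union> closed_segment a b) = {}"
    "ball ?p e \<inter> left_side a b \<subseteq> N"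
    using connected_strip_along_segment[OF assms(1,3) p p] by metis
  have ne: "ball ?p d \<inter> left_side a b \<noteq> {}" if "d > 0" for d
    using ball_left_side_nonempty[of ?p a b d] assms(2) that by simp
  then have "N \<noteq> {}" using N by blast
  then obtain L where L: "L \<in> components (- (K \<union> closed_segment a b))" "N \<subseteq> L"
    using exists_component_superset[of N "- (K \<union> closed_segment a b)"] N by blast
  have "\<exists>e>0. ball x e \<inter> left_side a b \<subseteq> L" if x: "x \<in> open_segment a b" for x
  proof -
    obtain N' e' where N': "e' > 0" "connected N'" "N' \<inter> (K \<union> closed_segment a b) = {}"
      "ball ?p e' \<inter> left_side a b \<subseteq> N'" "ball x e' \<inter> left_side a b \<subseteq> N'"
      using connected_strip_along_segment[OF assms(1,3) p x] by metis
    have "ball ?p (min e e') \<inter> left_side a b \<subseteq> L \<inter> N'" using N(4) L(2) N'(4) by auto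
    moreover have "ball ?p (min e e') \<inter> left_side a b \<noteq> {}" using ne[of "min e e'"] N N' by simp
    ultimately have "L \<inter> N' \<noteq> {}" by blast
    then have "N' \<subseteq> L" using components_maximal[OF L(1) N'(2)] N'(3) by blast
    then show ?thesis using N' by blast
  qed
  then show ?thesis using that L by blast
qed

text \<open>\<open>W\<close> is open, and it is closed relative to the component of
  \<open>- K\<close> around it: a new limit point there would have to lie in \<open>S - K\<close>,
  which \<open>away\<close> excludes. Being clopen and nonempty, \<open>W\<close> is that whole
  component.\<close>

lemma component_if_bounded_away:
  fixes W :: "'a :: real_normed_vector set"
  assumes W: "W \<in> components (- (K \<union> S))" and "closed K" "closed S"
    and away: "\<And>x. x \<in> S - K \<Longrightarrow> \<exists>e>0. ball x e \<inter> W = {}"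
  shows "W \<in> components (- K)"
proof -
  have W': "connected W" "W \<noteq> {}" "W \<subseteq> - (K \<union> S)"
    using in_components_connected[OF W] in_components_nonempty[OF W] in_components_subset[OF W]
    by auto
  have "open W" by (rule open_components[OF _ W]) (use assms(2,3) in auto)
  obtain C where C: "C \<in> components (- K)" "W \<subseteq> C"
    using exists_component_superset[of W "- K"] W' by blast
  obtain T where T: "closed T" "W = - (K \<union> S) \<inter> T"
    using closedin_component[OF W] by (auto simp: closedin_closed)
  have "closure W \<inter> C \<subseteq> W"
  proof
    fix z assume z: "z \<in> closure W \<inter> C"
    then have "z \<notin> K" using C in_components_subset by blast
    moreover have "z \<notin> S"
    proof
      assume "z \<in> S"
      then obtain e where "e > 0" "ball z e \<inter> W = {}" using away \<open>z \<notin> K\<close> by blast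
      then show False using z by (auto simp: closure_approachable dist_commute disjoint_iff)
    qed
    moreover have "z \<in> T" using z T closure_minimal[of W T] by blast
    ultimately show "z \<in> W" using T by blast
  qed
  then have "W = C \<inter> closure W" using C closure_subset by blast
  then have "closedin (top_of_set C) W" by (metis closed_closure closedin_closed_Int)
  moreover have "openin (top_of_set C) W" using \<open>open W\<close> C by (simp add: open_subset)
  ultimately have "W = C"
    using C W'(2) in_components_connected[OF C(1)] by (auto simp: connected_clopen)
  then show ?thesis using C by simp
qed

text \<open>\<open>U\<close> is the old component that contains the segment off \<open>K\<close>. A
  new component other than \<open>L\<close> and \<open>R\<close> stays away from the segment, hence
  is old. Whether \<open>L = R\<close> is left open so that pendant segments and chords can share
  this lemma; the last assumption covers an end \<open>a\<close> outside \<open>K\<close>, where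
  half discs do not suffice.\<close>

lemma components_Compl_Un_segment:
  fixes a b :: complex and K :: "complex set"
  defines "K' \<equiv> K \<union> closed_segment a b"
  assumes K: "closed K" and ab: "a \<noteq> b" "K \<inter> open_segment a b = {}" "b \<in> K"
    and L: "L \<in> components (- K')" "\<And>x. x \<in> open_segment a b \<Longrightarrow> \<exists>e>0. ball x e \<inter> left_side a b \<subseteq> L"
    and R: "R \<in> components (- K')" "\<And>x. x \<in> open_segment a b \<Longrightarrow> \<exists>e>0. ball x e \<inter> left_side b a \<subseteq> R"
    and a: "a \<in> K \<or> (\<exists>e>0. ball a e - closed_segment a b \<subseteq> L)"
  obtains U where "U \<in> components (- K)" "L \<notin> components (- K) - {U}" "R \<notin> components (- K) - {U}"
    "components (- K') = insert L (insert R (components (- K) - {U}))"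
proof -
  let ?p = "midpoint a b"
  have p: "?p \<in> open_segment a b" using ab(1) by simp
  \<comment> \<open>Depending on whether \<open>a\<close> lies in \<open>K\<close>, this is the open
    segment with or without \<open>a\<close>, so it lies between the open segment and its
    closure.\<close>
  have "connected (closed_segment a b - K)"
  proof (rule connected_intermediate_closure[of "open_segment a b"])
    show "open_segment a b \<subseteq> closed_segment a b - K"
      using ab segment_open_subset_closed by blast
    show "closed_segment a b - K \<subseteq> closure (open_segment a b)" using ab(1) by auto
  qed (simp add: convex_connected)
  then obtain U where U: "U \<in> components (- K)" "closed_segment a b - K \<subseteq> U"
    using exists_component_superset[of "closed_segment a b - K" "- K"] ab p by blast
  have pU: "?p \<in> U" using U p ab(2) segment_open_subset_closed[of a b] by blast
  have "open U" using open_components[OF _ U(1)] K by blast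
  then obtain r where r: "r > 0" "ball ?p r \<subseteq> U" using pU open_contains_ball by blast
  have side: "W \<notin> components (- K) - {U}"
    if W: "W \<in> components (- K')" and H: "\<exists>e>0. ball ?p e \<inter> left_side c d \<subseteq> W"
      and cd: "{c, d} = {a, b}" for W c d
  proof -
    obtain e where e: "e > 0" "ball ?p e \<inter> left_side c d \<subseteq> W" using H by blast
    have "c \<noteq> d" "?p \<in> closed_segment c d"
      using cd ab(1) by (auto simp: doubleton_eq_iff closed_segment_commute)
    then have "ball ?p (min e r) \<inter> left_side c d \<noteq> {}"
      using e r by (intro ball_left_side_nonempty) auto
    then have "W \<inter> U \<noteq> {}" using e(2) r(2) by (auto simp: disjoint_iff subset_iff)
    then show ?thesis using components_nonoverlap U(1) by blast
  qed
  have LU: "L \<notin> components (- K) - {U}" using side[OF L(1) L(2)[OF p]] by blast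
  have RU: "R \<notin> components (- K) - {U}" using side[OF R(1) R(2)[OF p]] by blast
  have "C \<in> components (- K')" if C: "C \<in> components (- K)" "C \<noteq> U" for C
  proof (rule components_intermediate_subset[OF C(1)])
    have "C \<inter> U = {}" using components_nonoverlap C U by blast
    then show "C \<subseteq> - K'" using U(2) in_components_subset[OF C(1)] by (auto simp: K'_def)
  qed (auto simp: K'_def)
  moreover have "W \<in> components (- K) - {U}" if W: "W \<in> components (- K')" "W \<noteq> L" "W \<noteq> R" for W
  proof -
    have disj: "W \<inter> L = {}" "W \<inter> R = {}" "W \<inter> closed_segment a b = {}"
      using components_nonoverlap W L(1) R(1) in_components_subset[OF W(1)] by (auto simp: K'_def)
    have "\<exists>e>0. ball x e \<inter> W = {}" if x: "x \<in> closed_segment a b - K" for x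
    proof (cases "x = a")
      case True
      then obtain e where "e > 0" "ball a e - closed_segment a b \<subseteq> L" using a x by blast
      then show ?thesis using True disj by blast
    next
      case False
      then have xo: "x \<in> open_segment a b" using x ab(3) by (auto simp: open_segment_def)
      obtain e1 where e1: "e1 > 0" "ball x e1 \<inter> left_side a b \<subseteq> L" using L(2) xo by blast
      obtain e2 where e2: "e2 > 0" "ball x e2 \<inter> left_side b a \<subseteq> R" using R(2) xo by blast
      obtain e3 where e3: "e3 > 0" "ball x e3 \<subseteq> left_side a b \<union> left_side b a \<union> open_segment a b"
        using ball_subset_sides_Un_segment xo by blast
      have "ball x (min e1 (min e2 e3)) \<subseteq> L \<union> R \<union> closed_segment a b"
      proof
        fix z assume "z \<in> ball x (min e1 (min e2 e3))"
        then have "z \<in> ball x e1" "z \<in> ball x e2" "z \<in> ball x e3" by auto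
        then show "z \<in> L \<union> R \<union> closed_segment a b"
          using e1 e2 e3 segment_open_subset_closed[of a b] by blast
      qed
      then have "ball x (min e1 (min e2 e3)) \<inter> W = {}" using disj by blast
      then show ?thesis using e1 e2 e3 by (metis min_less_iff_conj)
    qed
    then have "W \<in> components (- K)"
      using component_if_bounded_away[OF W(1)[unfolded K'_def] K] by auto
    moreover have "W \<noteq> U"
      using disj(3) pU p segment_open_subset_closed[of a b] by blast
    ultimately show ?thesis by blast
  qed
  ultimately have "components (- K') = insert L (insert R (components (- K) - {U}))"
    using L(1) R(1) by blast
  then show ?thesis using that[OF U(1) LU RU] by blast
qed

text \<open>One can walk around the free end \<open>a\<close>: a small disc there minus the segment
  is connected and meets both \<open>L\<close> and \<open>R\<close>. So \<open>L = R\<close>, and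
  one component replaces \<open>U\<close>.\<close>

lemma card_components_add_pendant_segment:
  fixes a b :: complex
  assumes K: "closed K" and ab: "a \<noteq> b" "K \<inter> open_segment a b = {}" "a \<notin> K" "b \<in> K"
    and fin: "finite (components (- K))"
  shows "finite (components (- (K \<union> closed_segment a b)))"
    "card (components (- (K \<union> closed_segment a b))) = card (components (- K))"
proof -
  let ?K' = "K \<union> closed_segment a b"
  obtain L where L: "L \<in> components (- ?K')"
    "\<And>x. x \<in> open_segment a b \<Longrightarrow> \<exists>e>0. ball x e \<inter> left_side a b \<subseteq> L"
    using side_component[OF K ab(1,2)] by blast
  obtain R where R: "R \<in> components (- ?K')"
    "\<And>x. x \<in> open_segment a b \<Longrightarrow> \<exists>e>0. ball x e \<inter> left_side b a \<subseteq> R"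
    using side_component[OF K ab(1)[symmetric]] ab(2)
    unfolding closed_segment_commute[of b a] open_segment_commute[of b a] by blast
  obtain e where e: "e > 0" "ball a e \<inter> K = {}"
    using open_contains_ball[of "- K"] K ab(3) by blast
  \<comment> \<open>Since \<open>b\<close> lies in \<open>K\<close>, the disc does not reach past
    \<open>b\<close>; on the ray from \<open>a\<close> through \<open>b\<close> it contains only
    points of the segment.\<close>
  have e_ab: "e \<le> norm (b - a)" using e ab(4)
    by (metis disjoint_iff dist_commute dist_norm leI mem_ball)
  \<comment> \<open>The half plane behind \<open>a\<close>. It links the left and the right half
    disc.\<close>
  define B where "B = {z. inner (b - a) z < inner (b - a) a}"
  have S: "ball a e - closed_segment a b
    = (ball a e \<inter> left_side a b) \<union> (ball a e \<inter> B) \<union> (ball a e \<inter> left_side b a)" (is "?S = ?S'")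
  proof
    show "?S \<subseteq> ?S'"
    proof
      fix z assume z: "z \<in> ?S"
      show "z \<in> ?S'"
      proof (rule ccontr)
        assume nz: "z \<notin> ?S'"
        then obtain t where t: "z = a + t *\<^sub>R (b - a)"
          using line_if_not_left_or_right[OF ab(1), of z] z by blast
        have "z \<notin> B" using nz z by blast
        then have "t * (norm (b - a))\<^sup>2 \<ge> 0"
          by (simp add: B_def t inner_add_right power2_norm_eq_inner)
        then have "t \<ge> 0" using ab(1) by (simp add: zero_le_mult_iff)
        moreover have "\<bar>t\<bar> * norm (b - a) < norm (b - a)"
          using z e_ab by (simp add: t dist_norm)
        then have "t \<le> 1" using ab(1) by simp
        ultimately have "z \<in> closed_segment a b"
          by (auto simp: in_segment t algebra_simps intro!: exI[of _ t])
        then show False using z by blast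
      qed
    qed
    have "B \<inter> closed_segment a b = {}"
    proof -
      have "inner (b - a) z \<ge> inner (b - a) a" if z: "z \<in> closed_segment a b" for z
      proof -
        obtain u where u: "z = a + u *\<^sub>R (b - a)" "u \<ge> 0"
          using z by (auto simp: in_segment algebra_simps)
        then show ?thesis by (simp add: inner_add_right)
      qed
      then show ?thesis by (force simp: B_def)
    qed
    then show "?S' \<subseteq> ?S"
      using left_side_segment_disjoint[of a b] left_side_segment_disjoint[of b a]
      by (auto simp: closed_segment_commute[of b a])
  qed
  have corner: "ball a e \<inter> left_side c d \<inter> B \<noteq> {}" if cd: "{c, d} = {a, b}" for c d
  proof -
    define s where "s = min (e / (2 * norm (b - a))) 1 / 2"
    have s: "s > 0" "s * norm (b - a) < e / 2"
    proof -
      show "s > 0" using e ab(1) by (simp add: s_def)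
      have "s < e / (2 * norm (b - a))" using e ab(1) by (simp add: s_def min_def field_simps)
      then show "s * norm (b - a) < e / 2" using ab(1) by (simp add: field_simps)
    qed
    define w where "w = (if c = a then \<i> * (b - a) else - \<i> * (b - a))"
    \<comment> \<open>Equal steps sideways and backwards from \<open>a\<close>. The bound
      \<open>s * norm (b - a) < e / 2\<close> keeps their sum within the disc.\<close>
    define z where "z = a + s *\<^sub>R w + (- s) *\<^sub>R (b - a)"
    have sq: "s * (norm (b - a))\<^sup>2 > 0" using s ab(1) by simp
    have "inner (b - a) w = 0" by (simp add: w_def)
    then have "inner (b - a) z = inner (b - a) a - s * (norm (b - a))\<^sup>2"
      by (simp add: z_def inner_add_right power2_norm_eq_inner del: scaleR_minus_left)
    then have "z \<in> B" using sq by (simp add: B_def)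
    moreover have "z \<in> left_side c d"
    proof (cases "c = a")
      case True
      then have "d = b" using cd by (auto simp: doubleton_eq_iff)
      have "inner (\<i> * (b - a)) z = inner (\<i> * (b - a)) a + s * (norm (b - a))\<^sup>2"
        using True by (simp add: z_def w_def inner_add_right del: scaleR_minus_left)
      then show ?thesis using True \<open>d = b\<close> sq by (simp add: left_side_def)
    next
      case False
      then have "c = b" "d = a" using cd by (auto simp: doubleton_eq_iff)
      have "inner (\<i> * (b - a)) z = inner (\<i> * (b - a)) a - s * (norm (b - a))\<^sup>2"
        using False by (simp add: z_def w_def inner_add_right inner_diff_right[of _ a] del: scaleR_minus_left)
      then show ?thesis using \<open>c = b\<close> \<open>d = a\<close> sq by (simp add: left_side_commute[of b a])
    qed
    moreover have "dist a z < e"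
    proof -
      have "dist a z = norm (s *\<^sub>R w - s *\<^sub>R (b - a))"
        by (simp add: dist_norm z_def norm_minus_commute algebra_simps)
      also have "\<dots> \<le> norm (s *\<^sub>R w) + norm (s *\<^sub>R (b - a))" by (rule norm_triangle_ineq4)
      also have "\<dots> = 2 * (s * norm (b - a))" using s by (simp add: w_def norm_mult)
      finally show ?thesis using s by simp
    qed
    ultimately show ?thesis by auto
  qed
  have convB: "convex B" unfolding B_def by (rule convex_halfspace_lt)
  have "connected ?S"
    unfolding S using corner[of a b] corner[of b a]
    by (intro connected_Un convex_connected convex_Int convex_ball convex_left_side convB) auto
  moreover have "?S \<subseteq> - ?K'" using e by blast
  ultimately have sub: "?S \<subseteq> W" if "W \<in> components (- ?K')" "W \<inter> ?S \<noteq> {}" for W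
    using components_maximal that by blast
  \<comment> \<open>The point \<open>x\<close> of the segment at distance \<open>e / 2\<close> from
    \<open>a\<close>: half discs at \<open>x\<close> lie in \<open>L\<close> and \<open>R\<close>,
    and small ones also lie in the slit disc.\<close>
  define u where "u = e / (2 * norm (b - a))"
  have u: "0 < u" "u < 1" "u * norm (b - a) < e" using e e_ab ab(1) by (simp_all add: u_def field_simps)
  define x where "x = a + u *\<^sub>R (b - a)"
  have x: "x \<in> open_segment a b"
    using u ab(1) unfolding in_segment x_def by (intro conjI exI[of _ u]) (auto simp: algebra_simps)
  have "x \<in> ball a e" using u by (simp add: x_def dist_norm)
  then obtain d where d: "d > 0" "ball x d \<subseteq> ball a e" using open_contains_ball open_ball by blast
  obtain eL where eL: "eL > 0" "ball x eL \<inter> left_side a b \<subseteq> L" using L(2)[OF x] by blast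
  obtain eR where eR: "eR > 0" "ball x eR \<inter> left_side b a \<subseteq> R" using R(2)[OF x] by blast
  have xc: "x \<in> closed_segment a b" "x \<in> closed_segment b a"
    using x segment_open_subset_closed closed_segment_commute by blast+
  have "ball x (min eL d) \<inter> left_side a b \<noteq> {}"
    using ball_left_side_nonempty[OF xc(1) ab(1), of "min eL d"] eL d by simp
  then have "L \<inter> ?S \<noteq> {}"
    using eL(2) d(2) left_side_segment_disjoint[of a b]
    by (simp add: disjoint_iff subset_iff) blast
  then have SL: "?S \<subseteq> L" using sub L(1) by blast
  have "ball x (min eR d) \<inter> left_side b a \<noteq> {}"
    using ball_left_side_nonempty[OF xc(2) ab(1)[symmetric], of "min eR d"] eR d by simp
  then have "R \<inter> ?S \<noteq> {}"
    using eR(2) d(2) left_side_segment_disjoint[of b a, unfolded closed_segment_commute[of b a]]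
    by (simp add: disjoint_iff subset_iff) blast
  then have "R \<inter> L \<noteq> {}" using SL by blast
  then have "R = L" using components_nonoverlap[OF R(1) L(1)] by simp
  obtain U where U: "U \<in> components (- K)" "L \<notin> components (- K) - {U}"
    "components (- ?K') = insert L (insert R (components (- K) - {U}))"
    using components_Compl_Un_segment[OF K ab(1,2,4) L R disjI2] SL e(1) by metis
  show "finite (components (- ?K'))" using U fin by simp
  show "card (components (- ?K')) = card (components (- K))"
    using U fin \<open>R = L\<close> card_Suc_Diff1[OF fin U(1)] by simp
qed

text \<open>An arc in \<open>K\<close> from \<open>a\<close> to \<open>b\<close> closes up with the
  chord to a Jordan curve. If \<open>L = R\<close>, a disc at the midpoint would lie in
  \<open>L\<close> apart from the chord, so the connected set \<open>L\<close> would meet both the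
  inside and the outside without crossing the curve.\<close>

lemma card_components_add_chord:
  fixes a b :: complex
  assumes K: "closed K" and ab: "a \<noteq> b" "K \<inter> open_segment a b = {}" "a \<in> K" "b \<in> K"
    and conn: "path_component K a b"
    and fin: "finite (components (- K))"
  shows "finite (components (- (K \<union> closed_segment a b)))"
    "card (components (- (K \<union> closed_segment a b))) = Suc (card (components (- K)))"
proof -
  let ?K' = "K \<union> closed_segment a b" and ?p = "midpoint a b"
  obtain L where L: "L \<in> components (- ?K')"
    "\<And>x. x \<in> open_segment a b \<Longrightarrow> \<exists>e>0. ball x e \<inter> left_side a b \<subseteq> L"
    using side_component[OF K ab(1,2)] by blast
  obtain R where R: "R \<in> components (- ?K')"
    "\<And>x. x \<in> open_segment a b \<Longrightarrow> \<exists>e>0. ball x e \<inter> left_side b a \<subseteq> R"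
    using side_component[OF K ab(1)[symmetric]] ab(2)
    unfolding closed_segment_commute[of b a] open_segment_commute[of b a] by blast
  obtain g0 where g0: "path g0" "path_image g0 \<subseteq> K" "pathstart g0 = a" "pathfinish g0 = b"
    using conn by (auto simp: path_component_def)
  obtain g where g: "arc g" "path_image g \<subseteq> K" "pathstart g = a" "pathfinish g = b"
    using path_contains_arc[OF g0(1,3,4) ab(1)] g0(2) by (metis subset_trans)
  define c where "c = g +++ linepath b a"
  have c: "simple_path c" "pathfinish c = pathstart c"
  proof -
    have "path_image g \<inter> closed_segment b a \<subseteq> {a, b}"
      using g(2) ab(2) by (auto simp: open_segment_def closed_segment_commute[of b a])
    then show "simple_path c" unfolding c_def using g ab(1)
      by (intro simple_path_join_loop) auto
  qed (simp add: c_def g)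
  let ?G = "path_image c"
  have G: "?G = path_image g \<union> closed_segment a b"
    by (simp add: c_def path_image_join g closed_segment_commute)
  have J: "open (inside ?G)" "open (outside ?G)" "inside ?G \<inter> outside ?G = {}"
    "inside ?G \<union> outside ?G = - ?G" "frontier (inside ?G) = ?G" "frontier (outside ?G) = ?G"
    using Jordan_inside_outside[OF c] c closed_simple_path_image
    by (auto simp: open_outside)
  have "L \<noteq> R"
  proof
    assume LR: "L = R"
    have p: "?p \<in> open_segment a b" using ab(1) by simp
    obtain e1 where e1: "e1 > 0" "ball ?p e1 \<inter> left_side a b \<subseteq> L" using L(2) p by blast
    obtain e2 where e2: "e2 > 0" "ball ?p e2 \<inter> left_side b a \<subseteq> R" using R(2) p by blast
    obtain e3 where e3: "e3 > 0" "ball ?p e3 \<subseteq> left_side a b \<union> left_side b a \<union> open_segment a b"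
      using ball_subset_sides_Un_segment p by blast
    define e where "e = min e1 (min e2 e3)"
    have e: "e > 0" "ball ?p e \<subseteq> L \<union> closed_segment a b"
    proof -
      show "ball ?p e \<subseteq> L \<union> closed_segment a b"
      proof
        fix z assume "z \<in> ball ?p e"
        then have "z \<in> ball ?p e1" "z \<in> ball ?p e2" "z \<in> ball ?p e3" by (auto simp: e_def)
        then show "z \<in> L \<union> closed_segment a b"
          using e1 e2 e3 LR segment_open_subset_closed[of a b] by blast
      qed
    qed (use e1 e2 e3 in \<open>simp add: e_def\<close>)
    have pG: "?p \<in> ?G" using G p segment_open_subset_closed by blast
    \<comment> \<open>The midpoint is on the frontier of either side of the Jordan curve, so every
      disc around it contains points of that side.\<close>
    have meet: "L \<inter> A \<noteq> {}" if A: "frontier A = ?G" "A \<inter> ?G = {}" for A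
    proof -
      have "?p \<in> closure A" using A pG by (auto simp: frontier_def)
      then obtain z where "z \<in> A" "dist z ?p < e" using e(1) closure_approachable by blast
      then show ?thesis using e(2) A(2) G by (auto simp: dist_commute subset_iff)
    qed
    have "L \<subseteq> inside ?G \<union> outside ?G"
      using in_components_subset[OF L(1)] g(2) J(4) G by blast
    moreover have "L \<inter> inside ?G \<noteq> {}" "L \<inter> outside ?G \<noteq> {}"
      using meet J(4-6) by blast+
    ultimately show False
      using in_components_connected[OF L(1)] J(1-3) unfolding connected_def by blast
  qed
  obtain U where U: "U \<in> components (- K)" "L \<notin> components (- K) - {U}" "R \<notin> components (- K) - {U}"
    "components (- ?K') = insert L (insert R (components (- K) - {U}))"
    using components_Compl_Un_segment[OF K ab(1,2,4) L R disjI1[OF ab(3)]] by metis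
  show "finite (components (- ?K'))" using U fin by simp
  show "card (components (- ?K')) = Suc (card (components (- K)))"
    using U fin \<open>L \<noteq> R\<close> card_Suc_Diff1[OF fin U(1)] by simp
qed

section \<open>Spanning trees and Euler's formula\<close>

lemma simple_graph_finite_edges:
  assumes "simple_graph V E"
  shows "finite E" "E \<subseteq> Pow V"
proof -
  show "E \<subseteq> Pow V" using assms by (auto simp: simple_graph_def)
  then show "finite E" using assms finite_subset[of E "Pow V"] by (auto simp: simple_graph_def)
qed

lemma simple_graph_edgeD:
  assumes "simple_graph V E" "{u, v} \<in> E"
  shows "u \<in> V" "v \<in> V" "u \<noteq> v"
proof -
  obtain a b where "a \<in> V" "b \<in> V" "a \<noteq> b" "{u, v} = {a, b}"
    using assms by (auto simp: simple_graph_def)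
  then show "u \<in> V" "v \<in> V" "u \<noteq> v" by (auto simp: doubleton_eq_iff)
qed

lemma simple_graph_edgeE:
  assumes "simple_graph V E" "e \<in> E"
  obtains u v where "e = {u, v}" "u \<in> V" "v \<in> V" "u \<noteq> v"
  using assms by (auto simp: simple_graph_def)

section \<open>Growing spanning trees\<close>

lemma rtrancl_crossing_edge:
  assumes "(x, y) \<in> r\<^sup>*" "x \<in> W" "y \<notin> W"
  obtains u v where "(u, v) \<in> r" "u \<in> W" "v \<notin> W"
  using assms by (induction rule: rtrancl_induct) blast+

text \<open>An induction principle for attaching one new vertex at a time. \<open>P\<close> is
  arbitrary because it is applied twice: to simple paths when counting the edges of a tree, and to
  faces in Euler's formula.\<close>

lemma connected_graph_spanning_growth:
  assumes sg: "simple_graph V E" and conn: "connected_graph V E" and v0: "v0 \<in> V"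
    and base: "P {v0} {}"
    and step: "\<And>W F w x. \<lbrakk>W \<subseteq> V; F \<subseteq> E; F \<subseteq> Pow W; w \<in> W; x \<in> V - W; {w, x} \<in> E; P W F\<rbrakk>
      \<Longrightarrow> P (insert x W) (insert {w, x} F)"
  obtains F where "F \<subseteq> E" "P V F" "Suc (card F) = card V"
proof -
  have finV: "finite V" using sg by (simp add: simple_graph_def)
  have "\<exists>W F. W \<subseteq> V \<and> v0 \<in> W \<and> card W = Suc n \<and> F \<subseteq> E \<and> F \<subseteq> Pow W \<and> card F = n \<and> P W F"
    if "n < card V" for n
    using that
  proof (induction n)
    case 0
    show ?case using v0 base by (intro exI[of _ "{v0}"] exI[of _ "{}"]) auto
  next
    case (Suc n)
    then obtain W F where IH: "W \<subseteq> V" "v0 \<in> W" "card W = Suc n" "F \<subseteq> E" "F \<subseteq> Pow W"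
      "card F = n" "P W F" by auto
    have fin: "finite W" "finite F"
      using IH finV simple_graph_finite_edges[OF sg] finite_subset by blast+
    have "W \<noteq> V" using IH(3) Suc.prems by auto
    then obtain y where y: "y \<in> V" "y \<notin> W" using IH(1) by blast
    have "(v0, y) \<in> {(x, y). {x, y} \<in> E}\<^sup>*" using conn v0 y by (simp add: connected_graph_def)
    then obtain w x where wx: "{w, x} \<in> E" "w \<in> W" "x \<notin> W"
      using rtrancl_crossing_edge[OF _ IH(2) y(2)] by blast
    have x: "x \<in> V - W" using simple_graph_edgeD[OF sg wx(1)] wx(3) by blast
    have "P (insert x W) (insert {w, x} F)" using step IH wx x by blast
    moreover have "{w, x} \<notin> F" using IH(5) wx(3) by blast
    then have "card (insert {w, x} F) = Suc n" using fin IH(6) by simp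
    moreover have "card (insert x W) = Suc (Suc n)" using fin IH(3) wx(3) by simp
    moreover have "insert {w, x} F \<subseteq> E" "insert {w, x} F \<subseteq> Pow (insert x W)" "insert x W \<subseteq> V" "v0 \<in> insert x W"
      using IH wx x by auto
    ultimately show ?case by blast
  qed
  moreover have "card V > 0" using finV v0 by (auto simp: card_gt_0_iff)
  ultimately obtain W F where *: "W \<subseteq> V" "card W = Suc (card V - 1)" "F \<subseteq> E" "card F = card V - 1" "P W F"
    by (meson diff_less zero_less_one)
  then have "W = V" using finV \<open>card V > 0\<close> by (intro card_subset_eq) auto
  then show ?thesis using that[of F] * \<open>card V > 0\<close> by simp
qed

text \<open>A spanning tree \<open>F\<close> grown inside \<open>T\<close> joins any two vertices by
  a simple path. An edge of \<open>T\<close> outside \<open>F\<close> would close such a path to a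
  cycle, so \<open>T = F\<close>.\<close>

lemma tree_graph_card:
  assumes "tree_graph V T"
  shows "Suc (card T) = card V"
proof -
  have sg: "simple_graph V T" and conn: "connected_graph V T" and ac: "acyclic_graph T"
    using assms by (auto simp: tree_graph_def)
  obtain v0 where v0: "v0 \<in> V" using conn by (auto simp: connected_graph_def)
  define P where "P = (\<lambda>W (F :: 'a set set). \<forall>u\<in>W. \<forall>v\<in>W. \<exists>xs. xs \<noteq> [] \<and> hd xs = u \<and> last xs = v
    \<and> distinct xs \<and> set xs \<subseteq> W \<and> successively (\<lambda>x y. {x, y} \<in> F) xs)"
  obtain F where F: "F \<subseteq> T" "P V F" "Suc (card F) = card V"
  proof (rule connected_graph_spanning_growth[OF sg conn v0, of P])
    show "P {v0} {}" by (auto simp: P_def intro!: exI[of _ "[v0]"])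
  next
    fix W F w x
    assume H: "F \<subseteq> Pow W" "w \<in> W" "x \<in> V - W" "P W F"
    let ?Q = "\<lambda>u v xs. xs \<noteq> [] \<and> hd xs = u \<and> last xs = v \<and> distinct xs \<and> set xs \<subseteq> insert x W
      \<and> successively (\<lambda>a b. {a, b} \<in> insert {w, x} F) xs"
    have old: "\<exists>xs. ?Q u v xs \<and> set xs \<subseteq> W" if uv: "u \<in> W" "v \<in> W" for u v
    proof -
      obtain xs where "xs \<noteq> []" "hd xs = u" "last xs = v" "distinct xs" "set xs \<subseteq> W"
        "successively (\<lambda>a b. {a, b} \<in> F) xs"
        using H(4)[unfolded P_def, rule_format, OF uv] by blast
      then show ?thesis by (intro exI[of _ xs]) (auto elim: successively_mono)
    qed
    have new: "\<exists>xs. ?Q u x xs" if u: "u \<in> W" for u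
    proof -
      obtain xs where "?Q u w xs" "set xs \<subseteq> W" using old[OF u H(2)] by blast
      then show ?thesis using H(3)
        by (intro exI[of _ "xs @ [x]"]) (auto simp: successively_append_iff)
    qed
    have new': "\<exists>xs. ?Q x u xs" if u: "u \<in> W" for u
    proof -
      obtain xs where "?Q u x xs" using new[OF u] by blast
      then show ?thesis
        by (intro exI[of _ "rev xs"]) (auto simp: hd_rev last_rev insert_commute)
    qed
    have "?Q x x [x]" by simp
    then show "P (insert x W) (insert {w, x} F)"
      unfolding P_def using old new new' by (metis insert_iff)
  qed
  have "T \<subseteq> F"
  proof
    fix e assume e: "e \<in> T"
    show "e \<in> F"
    proof (rule ccontr)
      assume eF: "e \<notin> F"
      obtain u v where uv: "e = {u, v}" "u \<in> V" "v \<in> V" "u \<noteq> v"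
        using simple_graph_edgeE[OF sg e] by blast
      obtain xs where xs: "xs \<noteq> []" "hd xs = u" "last xs = v" "distinct xs"
        "successively (\<lambda>x y. {x, y} \<in> F) xs"
        using F(2)[unfolded P_def, rule_format, OF uv(2,3)] by blast
      have edge: "{xs ! i, xs ! Suc i} \<in> F" if "Suc i < length xs" for i
        using xs(5) that by (simp add: successively_conv_nth)
      \<comment> \<open>Length one would mean \<open>u = v\<close>, and length two would put the
        edge \<open>e\<close> itself into \<open>F\<close>.\<close>
      have "length xs \<noteq> 1" "length xs \<noteq> 2"
        using xs uv eF edge[of 0] by (auto simp: length_Suc_conv numeral_2_eq_2)
      moreover have "length xs > 0" using xs(1) by simp
      ultimately have "3 \<le> length xs" by linarith
      moreover have "cycle_edges xs \<subseteq> T"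
      proof
        fix c assume "c \<in> cycle_edges xs"
        then obtain i where i: "i < length xs" "c = {xs ! i, xs ! (Suc i mod length xs)}"
          by (auto simp: cycle_edges_def)
        show "c \<in> T"
        proof (cases "Suc i < length xs")
          case True
          then show ?thesis using edge[of i] i F(1) by auto
        next
          case False
          then have "Suc i = length xs" using i by simp
          then have "c = {last xs, hd xs}"
            using i xs(1) by (simp add: last_conv_nth hd_conv_nth flip: \<open>Suc i = length xs\<close>)
          then show ?thesis using e uv xs by (simp add: insert_commute)
        qed
      qed
      ultimately show False using ac xs(4) by (auto simp: acyclic_graph_def)
    qed
  qed
  then show ?thesis using F by (metis subset_antisym)
qed

section \<open>Faces of a straight-line drawing\<close>

text \<open>Edges are unordered pairs; the convex hull gives the segment without choosing an order
  of its ends.\<close>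

definition drawing :: "complex set set \<Rightarrow> complex set" where
  "drawing E = (\<Union>e\<in>E. convex hull e)"

definition straight_line_plane_graph :: "complex set \<Rightarrow> complex set set \<Rightarrow> bool" where
  "straight_line_plane_graph V E \<longleftrightarrow> simple_graph V E
     \<and> (\<forall>u v. {u, v} \<in> E \<longrightarrow> V \<inter> open_segment u v = {}
          \<and> (\<forall>e\<in>E. e \<noteq> {u, v} \<longrightarrow> convex hull e \<inter> open_segment u v = {}))"

lemma closed_drawing:
  assumes "finite W" "finite F" "\<And>e. e \<in> F \<Longrightarrow> finite e"
  shows "closed (W \<union> drawing F)"
proof -
  have "closed (convex hull e)" if "e \<in> F" for e
    using assms(3)[OF that] by (simp add: compact_imp_closed finite_imp_compact_convex_hull)
  then show ?thesis
    using assms(1,2) unfolding drawing_def by (intro closed_Un closed_UN) (auto simp: finite_imp_closed)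
qed

lemma drawing_insert: "drawing (insert {u, v} F) = drawing F \<union> closed_segment u v"
  by (auto simp: drawing_def segment_convex_hull)

theorem Euler_straight_line_plane_graph:
  assumes pg: "straight_line_plane_graph V E" and conn: "connected_graph V E"
  shows "finite (components (- (V \<union> drawing E)))"
    "card (components (- (V \<union> drawing E))) + card V = card E + 2"
proof -
  have sg: "simple_graph V E" using pg by (simp add: straight_line_plane_graph_def)
  have finV: "finite V" and finE: "finite E"
    using sg simple_graph_finite_edges by (auto simp: simple_graph_def)
  have pgV: "V \<inter> open_segment u v = {}" if "{u, v} \<in> E" for u v
    using pg that by (simp add: straight_line_plane_graph_def)
  have pgE: "convex hull e \<inter> open_segment u v = {}" if "{u, v} \<in> E" "e \<in> E" "e \<noteq> {u, v}" for u v e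
    using pg that by (simp add: straight_line_plane_graph_def)
  have fin_e: "finite e" if "e \<in> E" for e using simple_graph_edgeE[OF sg that] by auto
  have cl: "closed (W \<union> drawing F)" if "W \<subseteq> V" "F \<subseteq> E" for W F
    using that finV finE fin_e by (intro closed_drawing) (auto intro: finite_subset)
  have disj: "(W \<union> drawing F) \<inter> open_segment u v = {}"
    if "W \<subseteq> V" "F \<subseteq> E" "{u, v} \<in> E" "{u, v} \<notin> F" for W F u v
  proof -
    have "convex hull e \<inter> open_segment u v = {}" if "e \<in> F" for e
      using pgE[OF \<open>{u, v} \<in> E\<close>, of e] that \<open>F \<subseteq> E\<close> \<open>{u, v} \<notin> F\<close> by auto
    then show ?thesis using pgV[OF that(3)] that(1) by (auto simp: drawing_def)
  qed
  obtain v0 where v0: "v0 \<in> V" using conn by (auto simp: connected_graph_def)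
  \<comment> \<open>Path-connectedness is carried along because the chords added later need a path
    in the drawing between their ends. The vertices belong to the drawing so that the start, one
    point without edges, is nonempty.\<close>
  define P where "P = (\<lambda>W F. finite (components (- (W \<union> drawing F)))
     \<and> card (components (- (W \<union> drawing F))) = 1
     \<and> (\<forall>u\<in>W. \<forall>v\<in>W. path_component (W \<union> drawing F) u v))"
  obtain F where F: "F \<subseteq> E" "P V F" "Suc (card F) = card V"
  proof (rule connected_graph_spanning_growth[OF sg conn v0, of P])
    have c: "connected (- {v0})" by (rule connected_punctured_universe) simp
    have "v0 + 1 \<in> - {v0}" by simp
    then have "components (- {v0}) = {- {v0}}"
      using c unfolding components_eq_sing_iff by blast
    moreover have "path_component {v0} v0 v0" by (simp add: path_component_refl)
    ultimately show "P {v0} {}" by (simp add: P_def drawing_def)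
  next
    fix W F w x
    assume H: "W \<subseteq> V" "F \<subseteq> E" "F \<subseteq> Pow W" "w \<in> W" "x \<in> V - W" "{w, x} \<in> E" "P W F"
    let ?K = "W \<union> drawing F" and ?K' = "insert x W \<union> drawing (insert {w, x} F)"
    have K': "?K' = ?K \<union> closed_segment x w"
      by (auto simp: drawing_insert closed_segment_commute)
    \<comment> \<open>The edges of \<open>F\<close> have their ends in \<open>W\<close>, so
      \<open>x\<close> could only be interior to an edge, which planarity forbids. Hence
      \<open>x\<close> is a free end.\<close>
    have "x \<notin> drawing F"
    proof
      assume "x \<in> drawing F"
      then obtain e where e: "e \<in> F" "x \<in> convex hull e" by (auto simp: drawing_def)
      then obtain u v where uv: "e = {u, v}" "u \<in> V" "v \<in> V" "u \<noteq> v"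
        using simple_graph_edgeE[OF sg] H(2) by blast
      then have "x \<in> open_segment u v"
        using e H(3,5) by (auto simp: open_segment_def segment_convex_hull)
      then show False using pgV[of u v] uv e H by blast
    qed
    then have xK: "x \<notin> ?K" using H(5) by blast
    have "{w, x} \<notin> F" using H(3,5) by blast
    then have d: "?K \<inter> open_segment x w = {}"
      using disj[OF H(1,2,6)] by (simp add: open_segment_commute)
    have wK: "w \<in> ?K" using H by blast
    have "x \<noteq> w" using H by blast
    note * = card_components_add_pendant_segment[OF cl[OF H(1,2)] \<open>x \<noteq> w\<close> d xK wK]
    have old: "path_component ?K' u v" if "u \<in> W" "v \<in> W" for u v
    proof -
      have "path_component ?K u v" using H(7) that by (simp add: P_def)
      then show ?thesis using path_component_of_subset[of ?K ?K'] unfolding K' by blast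
    qed
    have "path_component (closed_segment x w) x w"
      using convex_imp_path_connected[OF convex_closed_segment[of x w]]
      by (auto simp: path_connected_component)
    then have xw: "path_component ?K' x w"
      using path_component_of_subset[of "closed_segment x w" ?K'] unfolding K' by blast
    have "path_component ?K' u v" if "u \<in> insert x W" "v \<in> insert x W" for u v
    proof -
      have "path_component ?K' u w" "path_component ?K' v w"
        using that xw old[of _ w] H(4) by auto
      then show ?thesis using path_component_sym path_component_trans by metis
    qed
    then show "P (insert x W) (insert {w, x} F)"
      using * H(7) unfolding P_def K' by auto
  qed
  \<comment> \<open>\<open>G\<close> runs through sets of edges outside the spanning tree. Each is a
    chord and adds one face to the single face of the tree.\<close>
  have "finite (components (- (V \<union> drawing (F \<union> G))))
    \<and> card (components (- (V \<union> drawing (F \<union> G)))) = Suc (card G)" if "finite G" "G \<subseteq> E - F" for G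
    using that
  proof (induction G rule: finite_induct)
    case empty
    then show ?case using F(2) by (simp add: P_def)
  next
    case (insert e G)
    let ?K = "V \<union> drawing (F \<union> G)"
    have eE: "e \<in> E" "e \<notin> F \<union> G" "F \<union> G \<subseteq> E" using insert F(1) by auto
    obtain u v where uv: "e = {u, v}" "u \<in> V" "v \<in> V" "u \<noteq> v"
      using simple_graph_edgeE[OF sg eE(1)] by blast
    have K': "V \<union> drawing (F \<union> insert e G) = ?K \<union> closed_segment u v"
      by (simp add: uv drawing_insert Un_assoc)
    have "path_component (V \<union> drawing F) u v" using F(2) uv by (simp add: P_def)
    then have pc: "path_component ?K u v"
      using path_component_of_subset[of "V \<union> drawing F" ?K u v] by (auto simp: drawing_def)
    have d: "?K \<inter> open_segment u v = {}" using disj[of V "F \<union> G" u v] eE uv by simp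
    have IH: "finite (components (- ?K))" "card (components (- ?K)) = Suc (card G)"
      using insert by auto
    have "u \<in> ?K" "v \<in> ?K" using uv by auto
    note * = card_components_add_chord[OF cl[OF order_refl eE(3)] uv(4) d this pc IH(1)]
    show ?case unfolding K' using * IH insert by simp
  qed
  from this[of "E - F"] have "finite (components (- (V \<union> drawing E)))"
    "card (components (- (V \<union> drawing E))) = Suc (card (E - F))"
    using finE F(1) by (auto simp: Un_absorb1)
  moreover have "card (E - F) + card F = card E"
    using F(1) finE by (simp add: card_Diff_subset card_mono finite_subset)
  ultimately show "finite (components (- (V \<union> drawing E)))"
    "card (components (- (V \<union> drawing E))) + card V = card E + 2" using F(3) by auto
qed

section \<open>The graph of a set of segments\<close>

text \<open>Take \<open>u\<close> closest to \<open>z\<close>. This locates the vertex next to a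
  given point of a segment, and thereby the edges that a segment is cut into.\<close>

lemma nearest_point_on_segment:
  fixes a z :: "'a :: euclidean_space"
  assumes "finite V" "a \<in> V"
  obtains u where "u \<in> V" "u \<in> closed_segment a z" "V \<inter> open_segment u z = {}"
proof -
  let ?S = "V \<inter> closed_segment a z"
  have "finite ?S" "?S \<noteq> {}" using assms by auto
  then obtain u where u: "u \<in> ?S" "\<And>w. w \<in> ?S \<Longrightarrow> dist u z \<le> dist w z"
    using ex_min_if_finite[of "(\<lambda>w. dist w z) ` ?S"] by (auto simp: not_less)
  have "w \<notin> V" if "w \<in> open_segment u z" for w
  proof
    assume "w \<in> V"
    have "open_segment u z \<subseteq> closed_segment a z"
      using u(1) segment_open_subset_closed[of u z] closed_segment_subset[of u "closed_segment a z" z]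
      by auto
    then have "dist u z \<le> dist w z" using u(2) \<open>w \<in> V\<close> that by blast
    moreover have "dist w z < dist u z" using dist_in_open_segment[OF that] by (simp add: dist_commute)
    ultimately show False by simp
  qed
  then show ?thesis using that[of u] u(1) by blast
qed

text \<open>Turns questions about segments on a common line into questions about real
  intervals.\<close>

lemma segment_parametrised:
  fixes a d :: complex
  assumes "d \<noteq> 0"
  shows "closed_segment (a + p *\<^sub>R d) (a + q *\<^sub>R d) = (\<lambda>t. a + t *\<^sub>R d) ` closed_segment p q"
    "open_segment (a + p *\<^sub>R d) (a + q *\<^sub>R d) = (\<lambda>t. a + t *\<^sub>R d) ` open_segment p q"
proof -
  have 1: "closed_segment (a + p *\<^sub>R d) (a + q *\<^sub>R d) = (+) a ` closed_segment (p *\<^sub>R d) (q *\<^sub>R d)"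
    by (rule closed_segment_translation)
  have 2: "closed_segment (p *\<^sub>R d) (q *\<^sub>R d) = (\<lambda>t. t *\<^sub>R d) ` closed_segment p q"
    by (rule closed_segment_linear_image) (simp add: linear_iff scaleR_add_left)
  show cs: "closed_segment (a + p *\<^sub>R d) (a + q *\<^sub>R d) = (\<lambda>t. a + t *\<^sub>R d) ` closed_segment p q"
    unfolding 1 2 by (simp add: image_image)
  show "open_segment (a + p *\<^sub>R d) (a + q *\<^sub>R d) = (\<lambda>t. a + t *\<^sub>R d) ` open_segment p q"
    unfolding open_segment_def cs using assms by auto
qed

lemma in_segmentE:
  fixes a b :: complex
  assumes "z \<in> closed_segment a b"
  obtains t where "z = a + t *\<^sub>R (b - a)" "0 \<le> t" "t \<le> 1"
  using assms by (auto simp: in_segment algebra_simps)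

text \<open>For segment Halin graphs, \<open>fin_V\<close> comes from the finiteness of the
  underlying tree.\<close>

locale planar_segments =
  fixes M :: "complex set set"
  assumes segs: "segment_set M" and fin_V: "finite (graph_vertices M)"
begin

abbreviation "V \<equiv> graph_vertices M"
abbreviation "E \<equiv> graph_edges M"

lemma segE:
  assumes "s \<in> M"
  obtains a b where "a \<noteq> b" "s = closed_segment a b" "a \<in> V" "b \<in> V"
proof -
  obtain a b where ab: "a \<noteq> b" "s = closed_segment a b" using segs assms by (auto simp: segment_set_def)
  then have "a \<in> V" "b \<in> V" using assms
    by (auto simp: graph_vertices_def segment_endpoints_def closed_segment_commute)
  then show ?thesis using ab that by blast
qed

lemma edge_iff:
  "{u, v} \<in> E \<longleftrightarrow> u \<in> V \<and> v \<in> V \<and> u \<noteq> v \<and> (\<exists>s\<in>M. u \<in> s \<and> v \<in> s) \<and> V \<inter> open_segment u v = {}"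
  unfolding graph_edges_def by (auto simp: doubleton_eq_iff open_segment_commute)

lemma edgeE:
  assumes "e \<in> E"
  obtains u v s where "e = {u, v}" "u \<in> V" "v \<in> V" "u \<noteq> v" "s \<in> M" "u \<in> s" "v \<in> s"
    "V \<inter> open_segment u v = {}"
  using assms unfolding graph_edges_def by blast

lemma simple_graph: "simple_graph V E"
  unfolding simple_graph_def using fin_V by (blast elim: edgeE)

lemma convex_seg: "s \<in> M \<Longrightarrow> convex s"
  using segE convex_closed_segment by metis

text \<open>A common point of two segments is a vertex, so a point interior to one edge and lying on
  another edge forces both edges into the same segment. There they are intervals with no vertex
  inside, and overlapping ones coincide.\<close>

lemma plane_graph: "straight_line_plane_graph V E"
  unfolding straight_line_plane_graph_def
proof (intro conjI allI impI ballI)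
  fix u v e assume uv: "{u, v} \<in> E" and e: "e \<in> E" "e \<noteq> {u, v}"
  obtain s where s: "s \<in> M" "u \<in> s" "v \<in> s" and V_uv: "V \<inter> open_segment u v = {}" and "u \<noteq> v"
    using uv unfolding edge_iff by blast
  obtain u' v' s' where e': "e = {u', v'}" "u' \<in> V" "v' \<in> V" "u' \<noteq> v'" "s' \<in> M" "u' \<in> s'" "v' \<in> s'"
    "V \<inter> open_segment u' v' = {}" using edgeE[OF e(1)] by blast
  show "convex hull e \<inter> open_segment u v = {}"
  proof (rule ccontr)
    assume "convex hull e \<inter> open_segment u v \<noteq> {}"
    then obtain z where z: "z \<in> closed_segment u' v'" "z \<in> open_segment u v"
      by (auto simp: e' segment_convex_hull)
    have zs: "z \<in> s'" "z \<in> s"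
      using z s e' convex_seg closed_segment_subset[of _ s] closed_segment_subset[of _ s']
        segment_open_subset_closed[of u v] by blast+
    have "s = s'"
    proof (rule ccontr)
      assume "s \<noteq> s'"
      then have "z \<in> V" using zs s e' by (auto simp: graph_vertices_def intersection_points_def)
      then show False using z V_uv by blast
    qed
    obtain a b where ab: "a \<noteq> b" "s = closed_segment a b" using segE[OF s(1)] by blast
    let ?d = "b - a"
    have d: "?d \<noteq> 0" using ab by simp
    obtain p q p' q' where pq: "u = a + p *\<^sub>R ?d" "v = a + q *\<^sub>R ?d" "u' = a + p' *\<^sub>R ?d" "v' = a + q' *\<^sub>R ?d"
      using s e' \<open>s = s'\<close> ab by (metis in_segmentE)
    have inj: "(a + x *\<^sub>R ?d = a + y *\<^sub>R ?d) = (x = y)" for x y using d by simp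
    obtain r where r: "z = a + r *\<^sub>R ?d" "r \<in> open_segment p q"
      using z(2) unfolding pq segment_parametrised[OF d] by blast
    obtain r' where "z = a + r' *\<^sub>R ?d" "r' \<in> closed_segment p' q'"
      using z(1) unfolding pq segment_parametrised[OF d] by blast
    then have r': "r \<in> closed_segment p' q'" using r(1) inj by simp
    have n1: "p' \<notin> open_segment p q" "q' \<notin> open_segment p q"
      using V_uv e'(2,3) unfolding pq segment_parametrised[OF d] by blast+
    have "u \<in> V" "v \<in> V" using uv by (auto simp: edge_iff)
    then have n2: "p \<notin> open_segment p' q'" "q \<notin> open_segment p' q'"
      using e'(8) unfolding pq segment_parametrised[OF d] by blast+
    \<comment> \<open>Two intervals that meet at an inner point of the first, neither having an end
      of the other inside, have the same ends.\<close>
    have "(p = p' \<and> q = q') \<or> (p = q' \<and> q = p')"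
      using r(2) r' n1 n2 by (auto simp: closed_segment_eq_real_ivl open_segment_eq_real_ivl split: if_splits)
    then have "e = {u, v}" using e'(1) pq by auto
    then show False using e(2) by blast
  qed
next
  show "simple_graph V E" by (rule simple_graph)
next
  show "V \<inter> open_segment u v = {}" if "{u, v} \<in> E" for u v using that unfolding edge_iff by simp
qed

text \<open>A point of a segment that is no vertex lies on the edge between the nearest vertices on
  its two sides.\<close>

lemma drawing_eq: "V \<union> drawing E = \<Union>M"
proof
  show "V \<union> drawing E \<subseteq> \<Union>M"
  proof -
    have "convex hull e \<subseteq> \<Union>M" if "e \<in> E" for e
    proof -
      obtain u v s where e: "e = {u, v}" "s \<in> M" "u \<in> s" "v \<in> s" using edgeE[OF \<open>e \<in> E\<close>] by metis
      then have "convex hull e \<subseteq> s" using convex_seg by (intro hull_minimal) auto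
      then show ?thesis using e by blast
    qed
    moreover have "V \<subseteq> \<Union>M"
      by (auto simp: graph_vertices_def intersection_points_def segment_endpoints_def)
    ultimately show ?thesis by (auto simp: drawing_def)
  qed
  show "\<Union>M \<subseteq> V \<union> drawing E"
  proof
    fix z assume "z \<in> \<Union>M"
    then obtain s where s: "s \<in> M" "z \<in> s" by blast
    obtain a b where ab: "a \<noteq> b" "s = closed_segment a b" "a \<in> V" "b \<in> V" using segE[OF s(1)] by blast
    show "z \<in> V \<union> drawing E"
    proof (cases "z \<in> V")
      case False
      obtain u where u: "u \<in> V" "u \<in> closed_segment a z" "V \<inter> open_segment u z = {}"
        using nearest_point_on_segment[OF fin_V ab(3)] by blast
      obtain v where v: "v \<in> V" "v \<in> closed_segment b z" "V \<inter> open_segment v z = {}"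
        using nearest_point_on_segment[OF fin_V ab(4)] by blast
      \<comment> \<open>Betweenness is equality in the triangle inequality; the three equalities
        together place \<open>z\<close> between \<open>u\<close> and \<open>v\<close>.\<close>
      have "dist a b = dist a z + dist z b" "dist a z = dist a u + dist u z" "dist b z = dist b v + dist v z"
        using s ab u v by (simp_all add: between[symmetric] between_mem_segment)
      then have "dist u v = dist u z + dist z v"
        using dist_triangle[of a b u] dist_triangle[of u b v] dist_triangle[of u v z]
        by (simp add: dist_commute)
      then have "z \<in> closed_segment u v" by (simp add: between[symmetric] between_mem_segment)
      then have z: "z \<in> open_segment u v" using False u v by (auto simp: open_segment_def)
      then have "open_segment u v = open_segment u z \<union> {z} \<union> open_segment v z"
        using Un_open_segment[OF z] by (simp add: open_segment_commute)
      then have "V \<inter> open_segment u v = {}" using u v False by auto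
      moreover have "u \<noteq> v" using z by auto
      moreover have "u \<in> s" "v \<in> s"
        using u v s(2) ab closed_segment_subset[of a s z] closed_segment_subset[of b s z] by auto
      ultimately have "{u, v} \<in> E" using u v s by (auto simp: edge_iff)
      then show ?thesis using \<open>z \<in> closed_segment u v\<close> by (auto simp: drawing_def segment_convex_hull)
    qed simp
  qed
qed

text \<open>The complement of a bounded planar set has exactly one unbounded component, the one not
  counted as a circuit.\<close>

lemma circuits_card:
  assumes "finite (components (- \<Union>M))"
  shows "Suc (card (circuits M)) = card (components (- \<Union>M))"
proof -
  have "bounded s" if "s \<in> M" for s using segE[OF that] bounded_closed_segment by metis
  then have "bounded (\<Union>M)" using segs by (auto simp: segment_set_def intro!: bounded_Union)
  then obtain U where U: "U \<in> components (- \<Union>M)" "\<not> bounded U"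
    using cobounded_unbounded_components[of "- \<Union>M"] by auto
  have "bounded W" if "W \<in> components (- \<Union>M)" "W \<noteq> U" for W
    using cobounded_unique_unbounded_components[OF _ U that(1)] that(2) \<open>bounded (\<Union>M)\<close> by auto
  then have "circuits M = components (- \<Union>M) - {U}" using U by (auto simp: circuits_def)
  then show ?thesis using card_Suc_Diff1[OF assms U(1)] by simp
qed

lemma circuits_Euler:
  assumes "connected_graph V E"
  shows "card (circuits M) + card V = card E + 1"
  using Euler_straight_line_plane_graph[OF plane_graph assms] circuits_card
  unfolding drawing_eq by simp

text \<open>Choosing an edge inside each segment is injective: two segments with a common edge are
  collinear and meet, and \<open>segment_set\<close> then makes them equal.\<close>

lemma card_segments_le: "card M \<le> card E"
proof -
  have ex: "\<exists>e\<in>E. e \<subseteq> s" if s: "s \<in> M" for s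
  proof -
    obtain a b where ab: "a \<noteq> b" "s = closed_segment a b" "a \<in> V" "b \<in> V" using segE[OF s] by blast
    \<comment> \<open>With \<open>a\<close> removed, the vertex nearest to \<open>a\<close> is the
      other end of the edge of \<open>s\<close> at \<open>a\<close>.\<close>
    have "finite (V - {a})" "b \<in> V - {a}" using fin_V ab by auto
    then obtain u where u: "u \<in> V - {a}" "u \<in> closed_segment b a" "(V - {a}) \<inter> open_segment u a = {}"
      by (rule nearest_point_on_segment)
    have us: "u \<in> s" "a \<in> s" using u ab by (auto simp: closed_segment_commute)
    have "V \<inter> open_segment u a = {}" using u(3) by (auto simp: open_segment_def)
    then have "{u, a} \<in> E"
      unfolding edge_iff using u(1) us s ab(3) by (intro conjI bexI[of _ s]) auto
    then show ?thesis using us by (intro bexI[of _ "{u, a}"]) auto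
  qed
  then obtain f where f: "\<And>s. s \<in> M \<Longrightarrow> f s \<in> E \<and> f s \<subseteq> s" by metis
  have "inj_on f M"
  proof
    fix s t assume st: "s \<in> M" "t \<in> M" "f s = f t"
    obtain u v where uv: "f s = {u, v}" "u \<noteq> v" using edgeE f[OF st(1)] by metis
    have mem: "u \<in> s" "v \<in> s" "u \<in> t" "v \<in> t" using uv st f[of s] f[of t] by auto
    have "collinear {u, v, x}" if x: "x \<in> s \<union> t" for x
    proof -
      obtain w where w: "w \<in> M" "u \<in> w" "v \<in> w" "x \<in> w" using x mem st by blast
      then have "collinear w" using segE[OF w(1)] collinear_closed_segment by metis
      then show ?thesis using w by (elim collinear_subset) auto
    qed
    then have "collinear (insert u (insert v (s \<union> t)))"
      using collinear_triples[OF uv(2), THEN iffD2] by blast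
    then have "collinear (s \<union> t)"
      by (rule collinear_subset) auto
    then show "s = t"
      using segs st(1,2) mem(1,3) unfolding segment_set_def by (metis IntI empty_iff)
  qed
  moreover have "f ` M \<subseteq> E" using f by blast
  ultimately show ?thesis
    using simple_graph_finite_edges(1)[OF simple_graph] by (rule card_inj_on_le)
qed

text \<open>A vertex on just one segment is an end of it. All its neighbours then lie on one ray,
  where only the nearest vertex can be adjacent.\<close>

lemma intersection_point_if_degree_ge_2:
  assumes a: "a \<in> V" and deg: "vdegree E a \<ge> 2"
  shows "a \<in> intersection_points M"
proof (rule ccontr)
  assume nP: "a \<notin> intersection_points M"
  then obtain b where b: "closed_segment a b \<in> M"
    using a by (auto simp: graph_vertices_def segment_endpoints_def)
  have only: "t = closed_segment a b" if "t \<in> M" "a \<in> t" for t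
    using nP that b by (auto simp: intersection_points_def)
  obtain c d where "c \<noteq> d" "closed_segment a b = closed_segment c d" using segE[OF b] by metis
  then have "a \<noteq> b" by (auto simp: doubleton_eq_iff)
  let ?d = "b - a"
  have d: "?d \<noteq> 0" using \<open>a \<noteq> b\<close> by simp
  \<comment> \<open>\<open>a\<close> is written as \<open>a + 0 *\<^sub>R ?d\<close> to match the
    form of \<open>segment_parametrised\<close>.\<close>
  have nb: "\<exists>p>0. w = a + p *\<^sub>R ?d \<and> w \<in> V \<and> V \<inter> open_segment (a + 0 *\<^sub>R ?d) (a + p *\<^sub>R ?d) = {}"
    if w: "w \<in> neighbours E a" for w
  proof -
    have *: "w \<in> V" "a \<noteq> w" "V \<inter> open_segment a w = {}" "w \<in> closed_segment a b"
      using w only unfolding neighbours_def edge_iff mem_Collect_eq by blast+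
    obtain p where p: "w = a + p *\<^sub>R ?d" "0 \<le> p" "p \<le> 1" using in_segmentE[OF *(4)] by blast
    then have "p > 0" using *(2) by (cases "p = 0") auto
    then show ?thesis using p * by auto
  qed
  have "w = w'" if ww': "w \<in> neighbours E a" "w' \<in> neighbours E a" for w w'
  proof -
    obtain p where p: "p > 0" "w = a + p *\<^sub>R ?d" "w \<in> V"
      "V \<inter> open_segment (a + 0 *\<^sub>R ?d) (a + p *\<^sub>R ?d) = {}" using nb[OF ww'(1)] by blast
    obtain q where q: "q > 0" "w' = a + q *\<^sub>R ?d" "w' \<in> V"
      "V \<inter> open_segment (a + 0 *\<^sub>R ?d) (a + q *\<^sub>R ?d) = {}" using nb[OF ww'(2)] by blast
    have "p \<notin> open_segment 0 q" "q \<notin> open_segment 0 p"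
      using p q unfolding segment_parametrised[OF d] by blast+
    then have "p = q" using p(1) q(1) by (auto simp: open_segment_eq_real_ivl split: if_splits)
    then show ?thesis using p q by simp
  qed
  moreover have "finite (neighbours E a)"
    using fin_V by (rule finite_subset[rotated]) (auto simp: neighbours_def edge_iff)
  ultimately have "card (neighbours E a) \<le> 1" by (simp add: card_le_Suc0_iff_eq)
  then show False using deg by (simp add: vdegree_def)
qed

end

section \<open>Counting in Halin graphs\<close>

lemma Suc_mod_if_less: "i < n \<Longrightarrow> Suc i mod n = (if Suc i = n then 0 else Suc i)"
  by (simp add: mod_Suc)

lemma card_cycle_edges:
  assumes "distinct xs" "3 \<le> length xs"
  shows "card (cycle_edges xs) = length xs"
proof -
  let ?n = "length xs" and ?f = "\<lambda>i. {xs ! i, xs ! (Suc i mod length xs)}"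
  have "inj_on ?f {..<?n}"
  proof
    fix i j assume ij: "i \<in> {..<?n}" "j \<in> {..<?n}" "?f i = ?f j"
    have lt: "i < ?n" "j < ?n" "Suc i mod ?n < ?n" "Suc j mod ?n < ?n" 
      using ij by (auto intro!: mod_less_divisor)
    \<comment> \<open>In the second case each index is the cyclic successor of the other, which is
      impossible for length at least three.\<close>
    have "i = j \<or> i = Suc j mod ?n \<and> Suc i mod ?n = j"
      using ij(3) lt assms(1) by (auto simp: doubleton_eq_iff nth_eq_iff_index_eq)
    then show "i = j" using lt(1,2) assms(2) by (auto simp: Suc_mod_if_less split: if_splits)
  qed
  moreover have "cycle_edges xs = ?f ` {..<?n}" by (auto simp: cycle_edges_def)
  ultimately show ?thesis by (simp add: card_image)
qed

lemma cycle_edges_two_neighbours: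
  assumes "distinct xs" "3 \<le> length xs" "v \<in> set xs"
  obtains x y where "x \<in> set xs" "y \<in> set xs" "x \<noteq> y" "{v, x} \<in> cycle_edges xs" "{v, y} \<in> cycle_edges xs"
proof -
  let ?n = "length xs"
  obtain i where i: "i < ?n" "v = xs ! i" using assms(3) by (auto simp: in_set_conv_nth)
  define j where "j = (if i = 0 then ?n - 1 else i - 1)"
  have j: "j < ?n" "Suc j mod ?n = i" using i assms(2) by (auto simp: j_def)
  have "{v, xs ! (Suc i mod ?n)} \<in> cycle_edges xs" using i by (auto simp: cycle_edges_def)
  moreover have "{xs ! j, v} \<in> cycle_edges xs" using i j by (auto simp: cycle_edges_def)
  then have "{v, xs ! j} \<in> cycle_edges xs" by (simp add: insert_commute)
  moreover have "Suc i mod ?n \<noteq> j" using i assms(2) by (auto simp: Suc_mod_if_less j_def)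
  moreover have lt: "Suc i mod ?n < ?n" using i(1) by (intro mod_less_divisor) auto
  ultimately show ?thesis
    using that[of "xs ! (Suc i mod ?n)" "xs ! j"] j(1) assms(1) by (simp add: nth_eq_iff_index_eq)
qed

lemma two_le_vdegree_cycle:
  assumes "distinct xs" "3 \<le> length xs" "v \<in> set xs" "cycle_edges xs \<subseteq> E" "finite (neighbours E v)"
  shows "2 \<le> vdegree E v"
proof -
  obtain x y where xy: "x \<noteq> y" "{v, x} \<in> cycle_edges xs" "{v, y} \<in> cycle_edges xs"
    using cycle_edges_two_neighbours[OF assms(1-3)] by metis
  then have "{x, y} \<subseteq> neighbours E v" using assms(4) by (auto simp: neighbours_def)
  from card_mono[OF assms(5) this] show ?thesis using xy(1) by (simp add: vdegree_def)
qed

lemma finite_neighbours: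
  assumes "simple_graph V E"
  shows "finite (neighbours E v)" "neighbours E v \<subseteq> V"
proof -
  show "neighbours E v \<subseteq> V" using simple_graph_edgeD[OF assms] by (auto simp: neighbours_def)
  then show "finite (neighbours E v)" using assms by (auto simp: simple_graph_def intro: finite_subset)
qed

lemma sum_vdegree:
  assumes sg: "simple_graph V E"
  shows "(\<Sum>v\<in>V. vdegree E v) = 2 * card E"
proof -
  have "vdegree E v = card {e \<in> E. v \<in> e}" for v
  proof -
    have "bij_betw (\<lambda>w. {v, w}) (neighbours E v) {e \<in> E. v \<in> e}"
      unfolding bij_betw_def
    proof
      show "inj_on (\<lambda>w. {v, w}) (neighbours E v)" by (auto simp: inj_on_def doubleton_eq_iff)
      have "e \<in> (\<lambda>w. {v, w}) ` neighbours E v" if e: "e \<in> E" "v \<in> e" for e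
      proof -
        obtain x y where "e = {x, y}" using simple_graph_edgeE[OF sg e(1)] by metis
        then have "\<exists>w. e = {v, w}" using e(2) by auto
        then show ?thesis using e(1) by (auto simp: neighbours_def)
      qed
      then show "(\<lambda>w. {v, w}) ` neighbours E v = {e \<in> E. v \<in> e}" by (auto simp: neighbours_def)
    qed
    then show ?thesis by (simp add: vdegree_def bij_betw_same_card)
  qed
  moreover have "card {v \<in> V. v \<in> e} = 2" if e: "e \<in> E" for e
  proof -
    obtain x y where xy: "e = {x, y}" "x \<in> V" "y \<in> V" "x \<noteq> y" using simple_graph_edgeE[OF sg e] by metis
    then have "{v \<in> V. v \<in> e} = {x, y}" by auto
    then show ?thesis using xy(4) by simp
  qed
  ultimately show ?thesis
    using sum_multicount[of V E "(\<in>)" 2] sg simple_graph_finite_edges[OF sg]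
    by (simp add: simple_graph_def)
qed

lemma connected_graph_mono:
  assumes "connected_graph V E" "E \<subseteq> E'"
  shows "connected_graph V E'"
proof -
  have "{(x, y). {x, y} \<in> E}\<^sup>* \<subseteq> {(x, y). {x, y} \<in> E'}\<^sup>*"
    using assms(2) by (intro rtrancl_mono) auto
  then show ?thesis using assms(1) unfolding connected_graph_def by blast
qed

text \<open>Two adjacent leaves have no further neighbours, so by connectedness they are the whole
  tree. Hence a cycle edge of a Halin graph is never a tree edge.\<close>

lemma tree_graph_adjacent_leaves:
  assumes tree: "tree_graph V T" and xy: "x \<in> leaves V T" "y \<in> leaves V T" "{x, y} \<in> T"
  shows "V \<subseteq> leaves V T"
proof
  fix v assume v: "v \<in> V"
  show "v \<in> leaves V T"
  proof (rule ccontr)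
    assume nl: "v \<notin> leaves V T"
    have "(x, v) \<in> {(a, b). {a, b} \<in> T}\<^sup>*"
      using tree v xy(1) by (auto simp: tree_graph_def connected_graph_def leaves_def)
    moreover have "v \<notin> {x, y}" using nl xy by auto
    ultimately obtain u w where uw: "{u, w} \<in> T" "u \<in> {x, y}" "w \<notin> {x, y}"
      using rtrancl_crossing_edge[of x v _ "{x, y}"] by blast
    have card1: "card (neighbours T u) = 1" using uw(2) xy by (auto simp: leaves_def vdegree_def)
    define u' where "u' = (if u = x then y else x)"
    have "u' \<in> neighbours T u" "w \<in> neighbours T u" "u' \<noteq> w"
      using uw xy by (auto simp: neighbours_def u'_def insert_commute)
    then show False using card1 by (auto simp: card_1_singleton_iff)
  qed
qed

lemma halin_graph_counts:
  assumes "halin_graph_with_cycle V E C"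
  obtains l where "card V + 2 \<le> 2 * l" "l < card V" "card E + 1 = card V + l"
    "\<And>v. v \<in> V \<Longrightarrow> 2 \<le> vdegree E v" "connected_graph V E" "finite V"
proof -
  obtain T rot ls where pt: "plane_tree V T rot" and deg2: "\<And>v. v \<in> V \<Longrightarrow> vdegree T v \<noteq> 2"
    and nl: "\<exists>v\<in>V. v \<notin> leaves V T" and cw: "clockwise_leaves V T rot ls"
    and C: "C = cycle_edges ls" and E: "E = T \<union> C"
    using assms unfolding halin_graph_with_cycle_def by blast
  have tree: "tree_graph V T" using pt by (simp add: plane_tree_def)
  then have sg: "simple_graph V T" and conn: "connected_graph V T" by (auto simp: tree_graph_def)
  have finV: "finite V" using sg by (simp add: simple_graph_def)
  have ls: "distinct ls" "set ls = leaves V T" using cw by (auto simp: clockwise_leaves_def)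
  let ?L = "leaves V T"
  let ?l = "card ?L"
  have LV: "?L \<subseteq> V" by (auto simp: leaves_def)
  have len: "length ls = ?l" using ls distinct_card by metis
  have deg3: "3 \<le> vdegree T v" if "v \<in> V - ?L" for v
  proof -
    \<comment> \<open>\<open>cyclic_on\<close> holds only for nonempty sets, which excludes degree
      zero. Degree one means leaf and degree two is forbidden, so three remains.\<close>
    have "neighbours T v \<noteq> {}"
      using pt that by (auto simp: plane_tree_def cyclic_on_def)
    then have "vdegree T v \<noteq> 0" using finite_neighbours[OF sg] by (simp add: vdegree_def)
    then show ?thesis using deg2[of v] that by (auto simp: leaves_def)
  qed
  have "3 * card (V - ?L) + ?l \<le> (\<Sum>v\<in>V - ?L. vdegree T v) + (\<Sum>v\<in>?L. vdegree T v)"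
  proof (rule add_mono)
    show "3 * card (V - ?L) \<le> (\<Sum>v\<in>V - ?L. vdegree T v)"
      using sum_bounded_below[of "V - ?L" 3 "vdegree T"] deg3 by (simp add: mult.commute)
    show "?l \<le> (\<Sum>v\<in>?L. vdegree T v)" by (simp add: leaves_def)
  qed
  also have "\<dots> = 2 * card T" using sum_vdegree[OF sg] sum.subset_diff[OF LV finV, of "vdegree T"] by simp
  finally have hs: "3 * card (V - ?L) + ?l \<le> 2 * card T" .
  have cT: "Suc (card T) = card V" by (rule tree_graph_card[OF tree])
  have cV: "card (V - ?L) + ?l = card V"
    using LV finV by (metis card_Diff_subset card_mono finite_subset le_add_diff_inverse2)
  have "card (V - ?L) > 0" using nl finV by (auto simp: card_gt_0_iff)
  \<comment> \<open>With \<open>i > 0\<close> inner vertices and \<open>l\<close> leaves,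
    \<open>3 * i + l \<le> 2 * (i + l - 1)\<close> gives \<open>i + 2 \<le> l\<close>. So there are
    at least three leaves and the leaf cycle is a genuine cycle.\<close>
  then have l3: "3 \<le> ?l" "?l < card V" using hs cT cV by linarith+
  have cC: "card C = ?l" using card_cycle_edges[OF ls(1)] l3 len C by simp
  have "C \<inter> T = {}"
  proof (rule ccontr)
    assume "C \<inter> T \<noteq> {}"
    then obtain i where i: "i < length ls" "{ls ! i, ls ! (Suc i mod length ls)} \<in> T"
      by (auto simp: C cycle_edges_def)
    then have "ls ! i \<in> ?L" "ls ! (Suc i mod length ls) \<in> ?L"
      using ls(2) nth_mem[of _ ls] by (metis mod_less_divisor gr_implies_not0 neq0_conv)+
    then show False using tree_graph_adjacent_leaves[OF tree _ _ i(2)] nl by blast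
  qed
  moreover have "finite C" using cC l3 by (auto intro: card_ge_0_finite)
  ultimately have cE: "card E = card T + ?l"
    using simple_graph_finite_edges[OF sg] cC E by (simp add: card_Un_disjoint Int_commute)
  have "neighbours C v \<subseteq> V" for v
  proof
    fix w assume "w \<in> neighbours C v"
    then obtain i where i: "i < length ls" "{v, w} = {ls ! i, ls ! (Suc i mod length ls)}"
      by (auto simp: neighbours_def C cycle_edges_def)
    then have "{v, w} \<subseteq> set ls" by (metis empty_subsetI insert_subset mod_less_divisor nth_mem gr_implies_not0 neq0_conv)
    then show "w \<in> V" using ls(2) LV by blast
  qed
  then have "neighbours E v \<subseteq> V" for v
    using finite_neighbours(2)[OF sg] by (auto simp: neighbours_def E)
  then have finN: "finite (neighbours E v)" for v using finV by (rule finite_subset)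
  have "2 \<le> vdegree E v" if v: "v \<in> V" for v
  proof (cases "v \<in> ?L")
    case True
    then show ?thesis using two_le_vdegree_cycle[OF ls(1) _ _ _ finN, of v] l3 len ls(2) C E by auto
  next
    case False
    have "vdegree T v \<le> vdegree E v"
      unfolding vdegree_def by (rule card_mono[OF finN]) (auto simp: neighbours_def E)
    then show ?thesis using deg3[of v] v False by auto
  qed
  moreover have "connected_graph V E" using conn connected_graph_mono E by blast
  moreover have "card V + 2 \<le> 2 * ?l" using hs cT cV by linarith
  moreover have "card E + 1 = card V + ?l" using cE cT by linarith
  ultimately show ?thesis using that[of ?l] l3(2) finV by blast
qed

lemma segment_halin_graph_counts:
  assumes "segment_halin_graph M"
  shows "intersection_points M = graph_vertices M"
    "card (circuits M) + card (graph_vertices M) = card (graph_edges M) + 1"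
    "card M \<le> card (graph_edges M)"
    "card (graph_edges M) + 2 \<le> 2 * card (graph_vertices M)"
    "card (graph_edges M) + 3 \<le> 3 * card (circuits M)"
proof -
  obtain C where C: "halin_graph_with_cycle (graph_vertices M) (graph_edges M) C"
    and segs: "segment_set M" using assms by (auto simp: segment_halin_graph_def)
  obtain l where l: "card (graph_vertices M) + 2 \<le> 2 * l" "l < card (graph_vertices M)"
    "card (graph_edges M) + 1 = card (graph_vertices M) + l"
    "\<And>v. v \<in> graph_vertices M \<Longrightarrow> 2 \<le> vdegree (graph_edges M) v"
    "connected_graph (graph_vertices M) (graph_edges M)" "finite (graph_vertices M)"
    using halin_graph_counts[OF C] by blast
  interpret planar_segments M using segs l(6) by unfold_locales
  show "intersection_points M = graph_vertices M"
    using l(4) intersection_point_if_degree_ge_2 by (auto simp: graph_vertices_def)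
  show c: "card (circuits M) + card V = card E + 1" by (rule circuits_Euler[OF l(5)])
  show "card M \<le> card E" by (rule card_segments_le)
  \<comment> \<open>\<open>c\<close> and \<open>l(3)\<close> identify the number of circuits with
    \<open>l\<close>. The two claims are then \<open>l \<le> card V - 1\<close> and
    \<open>card V \<le> 2 * l - 2\<close> inserted into
    \<open>card E = card V + l - 1\<close>.\<close>
  show "card E + 2 \<le> 2 * card V" "card E + 3 \<le> 3 * card (circuits M)" using c l(1-3) by linarith+
qed

section \<open>Halin graphs inscribed in a parabola\<close>

text \<open>The passage back from a graph to segments. \<open>adj\<close> keeps edges at a vertex
  from merging into one segment, \<open>disj\<close> prevents new crossings, and \<open>deg\<close>
  makes every vertex an intersection point.\<close>

lemma segment_graph_of_drawing:
  fixes V :: "complex set"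
  assumes sg: "simple_graph V E" and deg: "\<And>v. v \<in> V \<Longrightarrow> 2 \<le> vdegree E v"
    and adj: "\<And>v x y. \<lbrakk>{v, x} \<in> E; {v, y} \<in> E; x \<noteq> y\<rbrakk> \<Longrightarrow> \<not> collinear {v, x, y}"
    and disj: "\<And>e e'. \<lbrakk>e \<in> E; e' \<in> E; e \<inter> e' = {}\<rbrakk> \<Longrightarrow> convex hull e \<inter> convex hull e' = {}"
  defines "M \<equiv> (hull) convex ` E"
  shows "segment_set M" "graph_vertices M = V" "graph_edges M = E" "card M = card E"
proof -
  have int: "convex hull e \<inter> convex hull e' \<subseteq> e \<inter> e'" if ee: "e \<in> E" "e' \<in> E" "e \<noteq> e'" for e e'
  proof (cases "e \<inter> e' = {}")
    case True
    then show ?thesis using disj ee by blast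
  next
    case False
    then obtain v where v: "v \<in> e" "v \<in> e'" by blast
    have other: "\<exists>x. f = {v, x}" if "f \<in> E" "v \<in> f" for f
      using simple_graph_edgeE[OF sg that(1)] that(2) by (metis insertE insert_commute singletonD)
    obtain x y where xy: "e = {v, x}" "e' = {v, y}" using other ee v by metis
    then have "\<not> collinear {v, x, y}" using adj ee by blast
    then have "\<not> collinear {x, v, y}" by (simp add: insert_commute)
    then have "closed_segment x v \<inter> closed_segment v y = {v}" using Int_closed_segment by blast
    then show ?thesis using v unfolding xy by (simp add: segment_convex_hull insert_commute)
  qed
  have inj: "inj_on ((hull) convex) E"
  proof
    fix e e' assume ee: "e \<in> E" "e' \<in> E" "convex hull e = convex hull e'"
    show "e = e'"
    proof (rule ccontr)
      assume "e \<noteq> e'"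
      then have "convex hull e \<subseteq> e" using int[OF ee(1,2)] ee(3) by blast
      moreover obtain u v where uv: "e = {u, v}" "u \<noteq> v" using simple_graph_edgeE[OF sg ee(1)] by metis
      ultimately have "closed_segment u v \<subseteq> {u, v}" by (simp add: segment_convex_hull)
      then have "open_segment u v = {}" by (auto simp: open_segment_def)
      then show False using uv by simp
    qed
  qed
  then show "card M = card E" unfolding M_def by (rule card_image)
  show "segment_set M"
    unfolding segment_set_def
  proof (intro conjI ballI impI)
    show "finite M" using simple_graph_finite_edges[OF sg] by (simp add: M_def)
    show "\<exists>a b. a \<noteq> b \<and> s = closed_segment a b" if s: "s \<in> M" for s
    proof -
      obtain e where e: "e \<in> E" "s = convex hull e" using s by (auto simp: M_def)
      then show ?thesis using simple_graph_edgeE[OF sg e(1)] segment_convex_hull by metis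
    qed
    fix s t assume st: "s \<in> M" "t \<in> M" "s \<noteq> t \<and> collinear (s \<union> t)"
    obtain e e' where e: "e \<in> E" "s = convex hull e" and e': "e' \<in> E" "t = convex hull e'"
      using st by (auto simp: M_def)
    have "e \<noteq> e'" using e e' st by blast
    have "e \<inter> e' = {}"
    proof (rule ccontr)
      assume "e \<inter> e' \<noteq> {}"
      then obtain v where v: "v \<in> e" "v \<in> e'" by blast
      obtain x where x: "e = {v, x}"
        using simple_graph_edgeE[OF sg e(1)] v(1) by (metis insertE insert_commute singletonD)
      obtain y where y: "e' = {v, y}"
        using simple_graph_edgeE[OF sg e'(1)] v(2) by (metis insertE insert_commute singletonD)
      have "\<not> collinear {v, x, y}" using adj[of v x y] e(1) e'(1) x y \<open>e \<noteq> e'\<close> by blast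
      moreover have "{v, x, y} \<subseteq> s \<union> t" using e e' x y hull_subset[of e convex] hull_subset[of e' convex] by auto
      ultimately show False using st(3) collinear_subset by blast
    qed
    then show "s \<inter> t = {}" using disj[OF e(1) e'(1)] e e' by simp
  qed
  \<comment> \<open>\<open>v\<close> lies on an edge of its own. If another edge passes through
    \<open>v\<close>, then by \<open>int\<close> the two edges share \<open>v\<close> as an
    end.\<close>
  have Vmem: "v \<in> e" if v: "v \<in> V" and e: "e \<in> E" "v \<in> convex hull e" for v e
  proof -
    have "neighbours E v \<noteq> {}" using deg[OF v] by (auto simp: vdegree_def)
    then obtain w where w: "{v, w} \<in> E" by (auto simp: neighbours_def)
    have "v \<in> convex hull {v, w}" by (simp add: hull_inc)
    then show ?thesis using int[OF e(1) w] e(2) by (cases "e = {v, w}") auto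
  qed
  show GV: "graph_vertices M = V"
  proof
    show "graph_vertices M \<subseteq> V"
      unfolding graph_vertices_def
    proof (rule Un_least)
      show "intersection_points M \<subseteq> V"
      proof
        fix z assume "z \<in> intersection_points M"
        then obtain e e' where e: "e \<in> E" "e' \<in> E" "convex hull e \<noteq> convex hull e'"
          "z \<in> convex hull e" "z \<in> convex hull e'"
          by (auto simp: intersection_points_def M_def)
        then have "z \<in> e" using int[of e e'] by blast
        then show "z \<in> V" using simple_graph_finite_edges(2)[OF sg] e(1) by blast
      qed
      show "segment_endpoints M \<subseteq> V"
      proof
        fix a assume "a \<in> segment_endpoints M"
        then obtain b e where e: "e \<in> E" "closed_segment a b = convex hull e"
          by (auto simp: segment_endpoints_def M_def)
        obtain u v where uv: "e = {u, v}" "u \<in> V" "v \<in> V" using simple_graph_edgeE[OF sg e(1)] by metis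
        then have "closed_segment a b = closed_segment u v" using e(2) by (simp add: segment_convex_hull)
        then have "{a, b} = {u, v}" by (rule closed_segment_eq[THEN iffD1])
        then show "a \<in> V" using uv by (auto simp: doubleton_eq_iff)
      qed
    qed
    show "V \<subseteq> graph_vertices M"
    proof
      fix v assume v: "v \<in> V"
      have "\<not> card (neighbours E v) \<le> Suc 0" using deg[OF v] by (simp add: vdegree_def)
      then obtain x y where xy: "{v, x} \<in> E" "{v, y} \<in> E" "x \<noteq> y"
        using finite_neighbours(1)[OF sg, of v] by (auto simp: card_le_Suc0_iff_eq neighbours_def)
      have "{v, x} \<noteq> {v, y}" using xy(3) by (auto simp: doubleton_eq_iff)
      then have "convex hull {v, x} \<noteq> convex hull {v, y}" using inj xy by (auto dest: inj_onD)
      moreover have "v \<in> convex hull {v, x}" "v \<in> convex hull {v, y}" by (simp_all add: hull_inc)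
      ultimately show "v \<in> graph_vertices M"
        using xy unfolding graph_vertices_def intersection_points_def M_def by blast
    qed
  qed
  show "graph_edges M = E"
  proof
    show "graph_edges M \<subseteq> E"
    proof
      fix f assume "f \<in> graph_edges M"
      then obtain u v s where uv': "f = {u, v}" "u \<in> V" "v \<in> V" "u \<noteq> v" "s \<in> M" "u \<in> s" "v \<in> s"
        unfolding graph_edges_def GV by blast
      then obtain e where uv: "f = {u, v}" "u \<in> V" "v \<in> V" "u \<noteq> v" "e \<in> E"
        "u \<in> convex hull e" "v \<in> convex hull e"
        by (auto simp: M_def)
      then have "u \<in> e" "v \<in> e" using Vmem by auto
      moreover obtain a b where "e = {a, b}" using simple_graph_edgeE[OF sg uv(5)] by metis
      ultimately have "f = e" using uv(1,4) by auto
      then show "f \<in> E" using uv by simp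
    qed
    show "E \<subseteq> graph_edges M"
    proof
      fix e assume e: "e \<in> E"
      obtain u v where uv: "e = {u, v}" "u \<in> V" "v \<in> V" "u \<noteq> v" using simple_graph_edgeE[OF sg e] by metis
      have "V \<inter> open_segment u v = {}"
      proof -
        have "z \<in> {u, v}" if "z \<in> V" "z \<in> open_segment u v" for z
          using Vmem[OF that(1) e] that(2) segment_open_subset_closed[of u v]
          by (auto simp: uv(1) segment_convex_hull)
        then show ?thesis by (auto simp: open_segment_def)
      qed
      moreover have "convex hull e \<in> M" "u \<in> convex hull e" "v \<in> convex hull e"
        using e uv by (auto simp: M_def hull_inc)
      ultimately show "e \<in> graph_edges M" unfolding graph_edges_def GV using uv by blast
    qed
  qed
qed

text \<open>The functional \<open>edge_form k j\<close> vanishes on the \<open>j\<close>-th side of the polygon with the corners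
  \<open>parabola_point 0, \<dots>, parabola_point k\<close> and is positive at its other corners.\<close>

definition parabola_point :: "nat \<Rightarrow> complex" where
  "parabola_point j = Complex (real j) ((real j)\<^sup>2)"

definition edge_form :: "nat \<Rightarrow> nat \<Rightarrow> complex \<Rightarrow> real" where
  "edge_form k j z = (if j < k then Im z - (2 * real j + 1) * Re z + real j * (real j + 1)
     else real k * Re z - Im z)"

definition parabola_polygon :: "nat \<Rightarrow> complex set" where
  "parabola_polygon k = {z. \<forall>j\<le>k. 0 \<le> edge_form k j z}"

text \<open>Because of the modulus, side \<open>k\<close> is the long upper chord from corner
  \<open>k\<close> back to corner \<open>0\<close>.\<close>

definition parabola_side :: "nat \<Rightarrow> nat \<Rightarrow> complex set" where
  "parabola_side k j = {parabola_point j, parabola_point (Suc j mod Suc k)}"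

section \<open>The convex polygon with corners on the parabola\<close>

lemma parabola_point_eq_iff [simp]: "parabola_point i = parabola_point j \<longleftrightarrow> i = j"
  by (auto simp: parabola_point_def)

lemma parabola_point_sel [simp]:
  "Re (parabola_point j) = real j" "Im (parabola_point j) = (real j)\<^sup>2"
  by (simp_all add: parabola_point_def)

lemma edge_form_affine:
  "edge_form k j ((1 - u) *\<^sub>R x + u *\<^sub>R y) = (1 - u) * edge_form k j x + u * edge_form k j y"
  by (simp add: edge_form_def algebra_simps)

lemma continuous_on_edge_form: "continuous_on A (edge_form k j)"
  unfolding edge_form_def by (cases "j < k") (auto intro!: continuous_intros)

text \<open>On the parabola each form factors over its two zeros, the ends of its side. The signs at
  the other corners can then be read off.\<close>

lemma edge_form_parabola_point:
  "edge_form k j (parabola_point i)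
    = (if j < k then (real i - real j) * (real i - real j - 1) else real i * (real k - real i))"
  by (simp add: edge_form_def power2_eq_square algebra_simps)

lemma edge_form_parabola_point_pos:
  assumes "i \<le> k" "j \<le> k" "parabola_point i \<notin> parabola_side k j"
  shows "0 < edge_form k j (parabola_point i)"
proof (cases "j < k")
  case True
  then have "i < j \<or> i > Suc j" using assms(3) by (auto simp: parabola_side_def)
  then show ?thesis
  proof
    assume "i < j"
    then have "real i - real j < 0" "real i - real j - 1 < 0" by auto
    then show ?thesis using True by (simp add: edge_form_parabola_point mult_neg_neg)
  next
    assume "i > Suc j"
    then have "real i - real j > 0" "real i - real j - 1 > 0" by auto
    then show ?thesis using True by (simp add: edge_form_parabola_point)
  qed
next
  case False
  then have "j = k" using assms(2) by simp
  then have "i \<noteq> 0" "i \<noteq> k" using assms(3) by (auto simp: parabola_side_def)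
  then show ?thesis using assms(1) \<open>j = k\<close> by (simp add: edge_form_parabola_point)
qed

lemma edge_form_parabola_side:
  assumes "j \<le> k" "z \<in> parabola_side k j"
  shows "edge_form k j z = 0"
proof (cases "j < k")
  case True
  then show ?thesis using assms(2) by (auto simp: parabola_side_def edge_form_parabola_point)
next
  case False
  then have "j = k" using assms(1) by simp
  then show ?thesis using assms(2) by (auto simp: parabola_side_def edge_form_parabola_point)
qed

lemma parabola_point_in_polygon: "i \<le> k \<Longrightarrow> parabola_point i \<in> parabola_polygon k"
proof -
  assume i: "i \<le> k"
  have "0 \<le> edge_form k j (parabola_point i)" if j: "j \<le> k" for j
  proof (cases "parabola_point i \<in> parabola_side k j")
    case True
    then show ?thesis using edge_form_parabola_side[OF j] by simp
  next
    case False
    then show ?thesis using edge_form_parabola_point_pos[OF i j] by simp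
  qed
  then show ?thesis by (simp add: parabola_polygon_def)
qed

lemma parabola_polygon_Int: "parabola_polygon k = (\<Inter>j\<in>{..k}. {z. 0 \<le> edge_form k j z})"
  by (auto simp: parabola_polygon_def)

lemma convex_parabola_polygon: "convex (parabola_polygon k)"
  unfolding parabola_polygon_Int
proof (rule convex_INT)
  fix j
  show "convex {z. 0 \<le> edge_form k j z}"
    unfolding convex_alt by (auto simp: edge_form_affine)
qed

lemma closed_parabola_polygon: "closed (parabola_polygon k)"
  unfolding parabola_polygon_Int
  by (intro closed_INT ballI closed_Collect_le continuous_on_edge_form continuous_on_const)

lemma interior_parabola_polygon:
  "interior (parabola_polygon k) = {z. \<forall>j\<le>k. 0 < edge_form k j z}" (is "_ = ?S")
proof
  have "?S = (\<Inter>j\<in>{..k}. {z. 0 < edge_form k j z})" by auto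
  then have "open ?S"
    by (simp only:) (intro open_INT ballI open_Collect_less continuous_on_edge_form continuous_on_const finite_atMost)
  moreover have "?S \<subseteq> parabola_polygon k" by (auto simp: parabola_polygon_def less_imp_le)
  ultimately show "?S \<subseteq> interior (parabola_polygon k)" by (simp add: interior_maximal)
  show "interior (parabola_polygon k) \<subseteq> ?S"
  proof
    fix z assume "z \<in> interior (parabola_polygon k)"
    then obtain e where e: "e > 0" "ball z e \<subseteq> parabola_polygon k" by (auto simp: mem_interior)
    \<comment> \<open>Every form has coefficient \<open>1\<close> or \<open>-1\<close> at
      \<open>Im z\<close>, so one vertical move up or down strictly lowers it. A point that permits
      both moves has all forms positive.\<close>
    let ?d = "Complex 0 (e / 2)"
    have "cmod ?d = e / 2" using e(1) by (simp add: complex_norm)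
    then have "z + ?d \<in> parabola_polygon k" "z - ?d \<in> parabola_polygon k"
      using e by (auto simp: dist_norm subset_iff)
    then have "0 \<le> edge_form k j (z + ?d)" "0 \<le> edge_form k j (z - ?d)" if "j \<le> k" for j
      using that by (auto simp: parabola_polygon_def)
    then have "0 < edge_form k j z" if "j \<le> k" for j
      using that e(1) by (cases "j < k") (fastforce simp: edge_form_def)+
    then show "z \<in> ?S" by blast
  qed
qed

lemma parabola_polygon_Re:
  assumes "2 \<le> k" "z \<in> parabola_polygon k"
  shows "0 \<le> Re z" "Re z \<le> real k" "Re z \<le> Im z"
proof -
  have *: "0 \<le> edge_form k j z" if "j \<le> k" for j using assms(2) that by (simp add: parabola_polygon_def)
  have low: "Re z \<le> Im z" and up: "Im z \<le> real k * Re z"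
    using *[of 0] *[of k] assms(1) by (simp_all add: edge_form_def)
  have "0 \<le> (real k - 1) * Re z" using low up by (simp add: algebra_simps)
  then show "0 \<le> Re z" using assms(1) by (simp add: zero_le_mult_iff)
  \<comment> \<open>The last short side and the upper chord meet at corner \<open>k\<close>, which
    bounds the real part by \<open>k\<close>.\<close>
  have "0 \<le> Im z - (2 * real (k - 1) + 1) * Re z + real (k - 1) * (real (k - 1) + 1)"
    using *[of "k - 1"] assms(1) by (simp add: edge_form_def)
  then have "(real k - 1) * Re z \<le> (real k - 1) * real k"
    using up assms(1) by (simp add: of_nat_diff algebra_simps)
  then show "Re z \<le> real k" using assms(1) by simp
  show "Re z \<le> Im z" by (rule low)
qed

lemma bounded_parabola_polygon:
  assumes "2 \<le> k"
  shows "bounded (parabola_polygon k)"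
proof -
  have "norm z \<le> real k + real k * real k" if z: "z \<in> parabola_polygon k" for z
  proof -
    note R = parabola_polygon_Re[OF assms z]
    have "Im z \<le> real k * Re z" using z by (auto simp: parabola_polygon_def edge_form_def)
    also have "\<dots> \<le> real k * real k" using R by (intro mult_left_mono) auto
    finally show ?thesis using R cmod_le[of z] by simp
  qed
  then show ?thesis by (auto simp: bounded_iff)
qed

text \<open>Consecutive forms differ by a multiple of the distance to the vertical line through
  their common corner: form \<open>j - 1\<close> minus form \<open>j\<close> is
  \<open>2 * (Re z - j)\<close>. On line \<open>j\<close> the two neighbouring forms thus confine
  \<open>Re z\<close> to the interval from \<open>j\<close> to \<open>j + 1\<close>.\<close>

lemma parabola_polygon_side:
  assumes k: "2 \<le> k" and z: "z \<in> parabola_polygon k" and j: "j \<le> k" "edge_form k j z = 0"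
  shows "z \<in> convex hull (parabola_side k j)"
proof -
  have *: "0 \<le> edge_form k i z" if "i \<le> k" for i using z that by (simp add: parabola_polygon_def)
  note R = parabola_polygon_Re[OF k z]
  show ?thesis
  proof (cases "j < k")
    case True
    then have Im: "Im z = (2 * real j + 1) * Re z - real j * (real j + 1)"
      using j(2) by (simp add: edge_form_def)
    have lo: "real j \<le> Re z"
    proof (cases "j = 0")
      case False
      then have "real (j - 1) = real j - 1" by (simp add: of_nat_diff)
      then have "0 \<le> Im z - (2 * (real j - 1) + 1) * Re z + (real j - 1) * real j"
        using *[of "j - 1"] True by (simp add: edge_form_def)
      then show ?thesis unfolding Im by (simp add: algebra_simps)
    qed (use R in simp)
    have hi: "Re z \<le> real j + 1"
    proof (cases "Suc j < k")
      case True
      then have "0 \<le> Im z - (2 * (real j + 1) + 1) * Re z + (real j + 1) * (real j + 2)"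
        using *[of "Suc j"] by (simp add: edge_form_def algebra_simps)
      then show ?thesis unfolding Im by (simp add: algebra_simps)
    next
      case False
      then have "real k = real j + 1" using True by linarith
      then show ?thesis using R by simp
    qed
    have "z = (1 - (Re z - real j)) *\<^sub>R parabola_point j + (Re z - real j) *\<^sub>R parabola_point (Suc j)"
      by (simp add: complex_eq_iff Im power2_eq_square algebra_simps)
    then have "z \<in> closed_segment (parabola_point j) (parabola_point (Suc j))"
      unfolding in_segment using lo hi by (intro exI[of _ "Re z - real j"]) auto
    then show ?thesis using True by (simp add: parabola_side_def segment_convex_hull)
  next
    case False
    then have "j = k" using j by simp
    have Im: "Im z = real k * Re z" using False j(2) by (simp add: edge_form_def)
    have "z = (1 - Re z / real k) *\<^sub>R parabola_point 0 + (Re z / real k) *\<^sub>R parabola_point k"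
      using k by (simp add: complex_eq_iff Im power2_eq_square)
    then have "z \<in> closed_segment (parabola_point 0) (parabola_point k)"
      unfolding in_segment using R k by (intro exI[of _ "Re z / real k"]) auto
    then show ?thesis using \<open>j = k\<close> by (simp add: parabola_side_def segment_convex_hull insert_commute)
  qed
qed

lemma edge_form_hull_zero:
  assumes "j \<le> k" "z \<in> convex hull (parabola_side k j)"
  shows "edge_form k j z = 0"
proof -
  obtain u where "z = (1 - u) *\<^sub>R parabola_point j + u *\<^sub>R parabola_point (Suc j mod Suc k)"
    using assms(2) by (auto simp: parabola_side_def segment_convex_hull[symmetric] in_segment)
  then show ?thesis using edge_form_parabola_side[OF assms(1)]
    by (simp add: edge_form_affine parabola_side_def)
qed

lemma cycle_edges_parabola_points:
  "cycle_edges (map parabola_point [0..<Suc k]) = parabola_side k ` {..k}"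
proof -
  let ?xs = "map parabola_point [0..<Suc k]"
  have nth: "?xs ! i = parabola_point i" if "i < Suc k" for i
    using that by (simp del: upt_Suc)
  have "cycle_edges ?xs = (\<lambda>i. {?xs ! i, ?xs ! (Suc i mod Suc k)}) ` {..k}"
    unfolding cycle_edges_def setcompr_eq_image by (simp add: lessThan_def[symmetric] lessThan_Suc_atMost del: upt_Suc)
  also have "\<dots> = parabola_side k ` {..k}"
  proof (rule image_cong[OF refl])
    fix i assume "i \<in> {..k}"
    then show "{?xs ! i, ?xs ! (Suc i mod Suc k)} = parabola_side k i"
      using nth[of i] nth[of "Suc i mod Suc k"] by (simp add: parabola_side_def del: upt_Suc mod_Suc)
  qed
  finally show ?thesis .
qed

text \<open>The form of a side vanishes on that side and is positive at all other vertices, which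
  settles every condition involving a cycle edge. Each tree edge has an end in the interior of the
  polygon, so the outer face is bounded by the sides alone.\<close>

lemma segment_halin_graph_from_inscribed_tree:
  assumes k: "2 \<le> k" and I: "I \<subseteq> interior (parabola_polygon k)"
    and V: "V = parabola_point ` {..k} \<union> I"
    and T: "\<And>e. e \<in> T \<Longrightarrow> \<exists>u\<in>I. \<exists>v\<in>V. e = {u, v}"
    and adjT: "\<And>v x y. \<lbrakk>{v, x} \<in> T; {v, y} \<in> T; x \<noteq> y\<rbrakk> \<Longrightarrow> \<not> collinear {v, x, y}"
    and disjT: "\<And>e e'. \<lbrakk>e \<in> T; e' \<in> T; e \<inter> e' = {}\<rbrakk> \<Longrightarrow> convex hull e \<inter> convex hull e' = {}"
    and pt: "plane_tree V T rot" and deg2: "\<And>v. v \<in> V \<Longrightarrow> vdegree T v \<noteq> 2"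
    and nl: "\<exists>v\<in>V. v \<notin> leaves V T"
    and cw: "clockwise_leaves V T rot (map parabola_point [0..<Suc k])"
  obtains M where "segment_halin_graph M" "card M = card V + k" "graph_vertices M = V"
    "card (graph_edges M) = card V + k"
proof -
  let ?H = "parabola_polygon k"
  define C where "C = parabola_side k ` {..k}"
  define E where "E = T \<union> C"
  define M where "M = (hull) convex ` E"
  have C_cyc: "C = cycle_edges (map parabola_point [0..<Suc k])"
    unfolding C_def by (rule cycle_edges_parabola_points[symmetric])
  have halin: "halin_graph_with_cycle V E C"
    unfolding halin_graph_with_cycle_def using pt deg2 nl cw C_cyc E_def by blast
  have tree: "tree_graph V T" using pt by (simp add: plane_tree_def)
  then have sgT: "simple_graph V T" by (simp add: tree_graph_def)
  have I_pos: "0 < edge_form k j z" if "z \<in> I" "j \<le> k" for z j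
    using I that unfolding interior_parabola_polygon by blast
  have V_pos: "0 < edge_form k j z" if "z \<in> V" "j \<le> k" "z \<notin> parabola_side k j" for z j
    using that I_pos edge_form_parabola_point_pos[of _ k j] unfolding V by blast
  have sideE: "\<exists>a b. parabola_side k j = {a, b} \<and> a \<in> V \<and> b \<in> V \<and> a \<noteq> b" if "j \<le> k" for j
  proof -
    have "Suc j mod Suc k \<le> k" by (simp add: less_Suc_eq_le[symmetric])
    moreover have "j \<noteq> Suc j mod Suc k" using that k by (cases "j = k") auto
    ultimately show ?thesis using that unfolding parabola_side_def V
      by (intro exI[of _ "parabola_point j"] exI[of _ "parabola_point (Suc j mod Suc k)"]) auto
  qed
  have sg: "simple_graph V E"
    unfolding simple_graph_def
  proof (intro conjI ballI)
    show "finite V" using sgT by (simp add: simple_graph_def)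
    fix e assume "e \<in> E"
    then consider "e \<in> T" | j where "j \<le> k" "e = parabola_side k j" by (auto simp: E_def C_def)
    then show "\<exists>u\<in>V. \<exists>v\<in>V. u \<noteq> v \<and> e = {u, v}"
    proof cases
      case 1
      then show ?thesis using sgT by (simp add: simple_graph_def)
    next
      case 2
      then show ?thesis using sideE by blast
    qed
  qed
  have TC: "T \<inter> C = {}"
  proof (rule ccontr)
    assume "T \<inter> C \<noteq> {}"
    then obtain j where j: "j \<le> k" "parabola_side k j \<in> T" by (auto simp: C_def)
    then obtain u where "u \<in> I" "u \<in> parabola_side k j" using T by blast
    then show False using I_pos[of u j] edge_form_parabola_side[of j k u] j by simp
  qed
  \<comment> \<open>A vertex on the line of a side would make the form of that side vanish, which
    happens only at its two ends.\<close>
  have adjC: "\<not> collinear {v, x, y}"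
    if C: "{v, x} \<in> C" and y: "{v, y} \<in> E" "x \<noteq> y" for v x y
  proof
    assume "collinear {v, x, y}"
    then have "collinear {v, y, x}" by (simp add: insert_commute)
    moreover have vx: "v \<noteq> x" "v \<noteq> y" "y \<in> V"
      using simple_graph_edgeD[OF sg, of v x] simple_graph_edgeD[OF sg, of v y] C y by (auto simp: E_def)
    ultimately obtain u where u: "y = u *\<^sub>R v + (1 - u) *\<^sub>R x" by (auto simp: collinear_3_expand)
    obtain j where j: "j \<le> k" "{v, x} = parabola_side k j" using C by (auto simp: C_def)
    have "edge_form k j v = 0" "edge_form k j x = 0"
      using edge_form_parabola_side[OF j(1)] j(2) by blast+
    then have "edge_form k j y = 0" using edge_form_affine[of k j "1 - u" v x] u by simp
    moreover have "y \<notin> parabola_side k j" using vx y(2) unfolding j(2)[symmetric] by blast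
    ultimately show False using V_pos[of y j] vx j by simp
  qed
  have disjC: "convex hull c \<inter> convex hull e = {}"
    if c: "c \<in> C" and e: "e \<in> E" and ce: "c \<inter> e = {}" for c e
  proof -
    obtain j where j: "j \<le> k" "c = parabola_side k j" using c by (auto simp: C_def)
    obtain a b where ab: "e = {a, b}" "a \<in> V" "b \<in> V" using simple_graph_edgeE[OF sg e] by metis
    have pos: "0 < edge_form k j a" "0 < edge_form k j b" using V_pos ab ce j by auto
    have "0 < edge_form k j z" if "z \<in> convex hull e" for z
    proof -
      obtain u where u: "0 \<le> u" "u \<le> 1" "z = (1 - u) *\<^sub>R a + u *\<^sub>R b"
        using \<open>z \<in> convex hull e\<close> by (auto simp: ab segment_convex_hull[symmetric] in_segment)
      show ?thesis
      proof (cases "u = 0")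
        case False
        then have "0 < u * edge_form k j b" "0 \<le> (1 - u) * edge_form k j a" using u pos by auto
        then show ?thesis using u by (simp add: edge_form_affine)
      qed (use u pos in simp)
    qed
    then show ?thesis using edge_form_hull_zero[OF j(1)] j(2) by force
  qed
  have deg: "2 \<le> vdegree E v" if v: "v \<in> V" for v
    by (rule halin_graph_counts[OF halin]) (use v in blast)
  have adj: "\<not> collinear {v, x, y}" if H: "{v, x} \<in> E" "{v, y} \<in> E" "x \<noteq> y" for v x y
  proof -
    consider "{v, x} \<in> C" | "{v, y} \<in> C" | "{v, x} \<in> T" "{v, y} \<in> T" using H E_def by blast
    then show ?thesis
    proof cases
      case 1
      then show ?thesis using adjC H by blast
    next
      case 2
      then show ?thesis using adjC[of v y x] H by (simp add: insert_commute)
    next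
      case 3
      then show ?thesis using adjT H by blast
    qed
  qed
  have disj: "convex hull e \<inter> convex hull e' = {}" if H: "e \<in> E" "e' \<in> E" "e \<inter> e' = {}" for e e'
  proof -
    consider "e \<in> C" | "e' \<in> C" | "e \<in> T" "e' \<in> T" using H E_def by blast
    then show ?thesis
    proof cases
      case 1
      then show ?thesis using disjC H by blast
    next
      case 2
      then show ?thesis using disjC[of e' e] H by (simp add: Int_commute)
    next
      case 3
      then show ?thesis using disjT H by blast
    qed
  qed
  have M: "segment_set M" "graph_vertices M = V" "graph_edges M = E" "card M = card E"
    unfolding M_def by (rule segment_graph_of_drawing[OF sg deg adj disj]; assumption)+
  have UM: "\<Union>M = (\<Union>e\<in>E. convex hull e)" by (simp add: M_def)
  have VH: "V \<subseteq> ?H" using I interior_subset[of ?H] parabola_point_in_polygon unfolding V by auto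
  have MH: "\<Union>M \<subseteq> ?H"
  proof -
    have "convex hull e \<subseteq> ?H" if "e \<in> E" for e
    proof (rule hull_minimal[of e ?H convex, OF _ convex_parabola_polygon])
      show "e \<subseteq> ?H" using simple_graph_finite_edges(2)[OF sg] that VH by blast
    qed
    then show ?thesis unfolding UM by blast
  qed
  have fr: "frontier ?H = ?H - interior ?H"
    by (simp add: frontier_def closure_closed closed_parabola_polygon)
  have "frontier ?H \<subseteq> \<Union>M"
  proof
    fix z assume "z \<in> frontier ?H"
    then have z: "z \<in> ?H" "z \<notin> interior ?H" by (auto simp: fr)
    then obtain j where j: "j \<le> k" "\<not> 0 < edge_form k j z" unfolding interior_parabola_polygon by blast
    then have "edge_form k j z = 0" using z(1) by (auto simp: parabola_polygon_def intro: antisym)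
    then have "z \<in> convex hull (parabola_side k j)" using parabola_polygon_side[OF k z(1) j(1)] by blast
    moreover have "parabola_side k j \<in> E" using j(1) by (simp add: E_def C_def)
    ultimately show "z \<in> \<Union>M" unfolding UM by blast
  qed
  \<comment> \<open>The drawing contains the whole frontier of the polygon and lies inside the
    convex polygon, so both sets have the same outside.\<close>
  then have "outside (\<Union>M) \<subseteq> - ?H"
    using outside_mono[of "frontier ?H" "\<Union>M"]
      outside_frontier_eq_complement_closure[OF bounded_parabola_polygon[OF k] convex_parabola_polygon]
    by (simp add: closure_closed closed_parabola_polygon)
  moreover have "- ?H \<subseteq> outside (\<Union>M)" by (rule outside_subset_convex[OF convex_parabola_polygon MH])
  ultimately have "outside (\<Union>M) = - ?H" by blast
  then have fo: "frontier (outside (\<Union>M)) = ?H - interior ?H" by (simp add: frontier_complement fr)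
  have C_sub: "convex hull c \<subseteq> ?H - interior ?H" if c: "c \<in> C" for c
  proof
    fix z assume z: "z \<in> convex hull c"
    obtain j where j: "j \<le> k" "c = parabola_side k j" using c by (auto simp: C_def)
    have "edge_form k j z = 0" using edge_form_hull_zero[OF j(1)] z j(2) by blast
    then have "z \<notin> interior ?H" unfolding interior_parabola_polygon using j(1) by force
    moreover have "z \<in> ?H" using z MH c unfolding UM E_def by blast
    ultimately show "z \<in> ?H - interior ?H" by blast
  qed
  have T_sub: "\<not> convex hull e \<subseteq> ?H - interior ?H" if e: "e \<in> T" for e
  proof -
    obtain u where "u \<in> I" "u \<in> e" using T[OF e] by blast
    then show ?thesis using I hull_inc[of u e convex] by blast
  qed
  have "outer_face_edges M = C"
  proof
    show "outer_face_edges M \<subseteq> C"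
    proof
      fix e assume "e \<in> outer_face_edges M"
      then have "e \<in> E" "convex hull e \<subseteq> ?H - interior ?H"
        by (auto simp: outer_face_edges_def M(3) fo segment_convex_hull)
      then show "e \<in> C" using T_sub E_def by blast
    qed
    show "C \<subseteq> outer_face_edges M"
    proof
      fix c assume c: "c \<in> C"
      then have cE: "c \<in> E" by (simp add: E_def)
      obtain a b where ab: "c = {a, b}" using simple_graph_edgeE[OF sg cE] by metis
      have "closed_segment a b \<subseteq> frontier (outside (\<Union>M))"
        using C_sub[OF c] unfolding fo ab by (simp add: segment_convex_hull)
      then show "c \<in> outer_face_edges M" using cE unfolding outer_face_edges_def M(3) ab by blast
    qed
  qed
  then have "segment_halin_graph M"
    unfolding segment_halin_graph_def using M halin by auto
  \<comment> \<open>The tree contributes \<open>card V - 1\<close> edges, the cycle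
    \<open>k + 1\<close>.\<close>
  moreover have "card E = card V + k"
  proof -
    have "card C = Suc k"
      using card_cycle_edges[of "map parabola_point [0..<Suc k]"] k unfolding C_cyc
      by (simp add: distinct_map inj_on_def del: upt_Suc)
    moreover have "finite C" by (simp add: C_def)
    ultimately show ?thesis
      using TC tree_graph_card[OF tree] simple_graph_finite_edges(1)[OF sgT]
      by (simp add: E_def card_Un_disjoint)
  qed
  ultimately show ?thesis using that[of M] M by simp
qed

section \<open>Wheels and caterpillars\<close>

lemma cyclic_on_image_lessThan:
  assumes "0 < n" "\<And>i. i < n \<Longrightarrow> f (x i) = x (Suc i mod n)"
  shows "cyclic_on f (x ` {..<n})"
proof -
  have pow: "(f ^^ m) (x 0) = x (m mod n)" for m
  proof (induction m)
    case (Suc m)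
    then show ?case using assms by (simp add: mod_Suc_eq)
  qed simp
  have "orbit f (x 0) = x ` {..<n}"
  proof
    show "orbit f (x 0) \<subseteq> x ` {..<n}" using assms(1) by (auto simp: orbit_altdef pow)
    show "x ` {..<n} \<subseteq> orbit f (x 0)"
    proof
      fix y assume "y \<in> x ` {..<n}"
      then obtain i where "i < n" "y = x i" by auto
      \<comment> \<open>An extra round of \<open>n\<close> steps, because \<open>orbit\<close>
        counts only positive numbers of iterations.\<close>
      then have "y = (f ^^ (i + n)) (x 0)" "0 < i + n" by (simp_all add: pow)
      then show "y \<in> orbit f (x 0)" unfolding orbit_altdef by blast
    qed
  qed
  moreover have "x 0 \<in> x ` {..<n}" using assms(1) by simp
  ultimately show ?thesis unfolding cyclic_on_def by metis
qed

lemma cyclic_on_singleton: "f a = a \<Longrightarrow> cyclic_on f {a}"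
  using cyclic_on_image_lessThan[of 1 f "\<lambda>_. a"] by (simp add: lessThan_Suc)

lemma cyclic_on_triple:
  assumes "f a = b" "f b = c" "f c = a"
  shows "cyclic_on f {a, b, c}"
proof -
  have "(f ^^ 3) a = a" by (simp add: numeral_3_eq_3 assms)
  then have "orbit f a = {(f ^^ m) a | m. m < 3}" by (rule orbit_altdef_bounded) simp
  also have "\<dots> = (\<lambda>m. (f ^^ m) a) ` {..<3}" by auto
  also have "\<dots> = {a, b, c}" by (auto simp: numeral_3_eq_3 lessThan_Suc assms)
  finally show ?thesis unfolding cyclic_on_def by blast
qed

text \<open>On a cycle, a vertex of maximal rank would have two different neighbours of no larger
  rank.\<close>

lemma acyclic_graph_if_rank:
  fixes r :: "'a \<Rightarrow> 'b :: linorder"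
  assumes "\<And>v w w'. \<lbrakk>{v, w} \<in> E; {v, w'} \<in> E; r w \<le> r v; r w' \<le> r v\<rbrakk> \<Longrightarrow> w = w'"
  shows "acyclic_graph E"
  unfolding acyclic_graph_def
proof safe
  fix xs assume xs: "distinct xs" "3 \<le> length xs" "cycle_edges xs \<subseteq> E"
  have "finite (r ` set xs)" "r ` set xs \<noteq> {}" using xs(2) by auto
  then have "Max (r ` set xs) \<in> r ` set xs" by (rule Max_in)
  then obtain v where v: "v \<in> set xs" "Max (r ` set xs) = r v" by blast
  have max: "r w \<le> r v" if "w \<in> set xs" for w using that unfolding v(2)[symmetric] by simp
  obtain x y where "x \<in> set xs" "y \<in> set xs" "x \<noteq> y" "{v, x} \<in> cycle_edges xs" "{v, y} \<in> cycle_edges xs"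
    using cycle_edges_two_neighbours[OF xs(1,2) v(1)] by blast
  then show False using assms[of v x y] max xs(3) by blast
qed

lemma connected_graph_if_root:
  assumes "a \<in> V" "\<And>v. v \<in> V \<Longrightarrow> (a, v) \<in> {(x, y). {x, y} \<in> E}\<^sup>*"
  shows "connected_graph V E"
proof -
  let ?r = "{(x, y). {x, y} \<in> E}"
  have "sym ?r" by (auto simp: sym_def insert_commute)
  then have "sym (?r\<^sup>*)" by (rule sym_rtrancl)
  then have "(u, v) \<in> ?r\<^sup>*" if "u \<in> V" "v \<in> V" for u v
    using assms(2)[OF that(1)] assms(2)[OF that(2)] by (meson symD rtrancl_trans)
  then show ?thesis using assms(1) unfolding connected_graph_def by blast
qed

lemma collinear_complex_cross:
  fixes a b c :: complex
  assumes "collinear {a, b, c}"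
  shows "(Re b - Re a) * (Im c - Im a) = (Re c - Re a) * (Im b - Im a)"
proof -
  have "collinear {b, a, c}" using assms by (simp add: insert_commute)
  then have "b = c \<or> (\<exists>u. a = u *\<^sub>R b + (1 - u) *\<^sub>R c)" by (simp add: collinear_3_expand)
  then show ?thesis
  proof
    assume "\<exists>u. a = u *\<^sub>R b + (1 - u) *\<^sub>R c"
    then obtain u where a: "a = u *\<^sub>R b + (1 - u) *\<^sub>R c" by blast
    show ?thesis unfolding a by (simp add: algebra_simps)
  qed simp
qed

lemma parabola_point_nth:
  assumes "i < Suc k"
  shows "map parabola_point [0..<Suc k] ! i = parabola_point i"
  using assms by (simp del: upt_Suc)

lemma clockwise_leaves_parabola_points:
  assumes "leaves V T = parabola_point ` {..k}"
    and "\<And>i. i \<le> k \<Longrightarrow> \<exists>u. contour T rot (parabola_point i) u (parabola_point (Suc i mod Suc k))"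
  shows "clockwise_leaves V T rot (map parabola_point [0..<Suc k])"
  unfolding clockwise_leaves_def
proof (intro conjI allI impI)
  let ?xs = "map parabola_point [0..<Suc k]"
  show "distinct ?xs" by (simp add: distinct_map inj_on_def del: upt_Suc)
  show "set ?xs = leaves V T" unfolding assms(1) set_map set_upt by (simp add: atLeast0LessThan lessThan_Suc_atMost)
  fix i assume "i < length ?xs"
  then have i: "i < Suc k" by simp
  have *: "Suc i mod Suc k < Suc k" by simp
  have "length ?xs = Suc k" by simp
  then show "next_leaf V T rot (?xs ! i) (?xs ! (Suc i mod length ?xs))"
    unfolding next_leaf_def assms(1) using assms(2)[of i] i *
    by (simp only: parabola_point_nth less_Suc_eq_le image_iff) blast
qed

text \<open>The coordinates are chosen so that, by parity, the hub lies on no line through two points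
  \<open>(i, i\<^sup>2)\<close>, \<open>(j, j\<^sup>2)\<close> with integers \<open>i\<close>, \<open>j\<close>.\<close>

definition wheel_hub :: complex where
  "wheel_hub = Complex (1 / 2) (3 / 4)"

lemma wheel_hub_neq [simp]: "wheel_hub \<noteq> parabola_point j" "parabola_point j \<noteq> wheel_hub"
proof -
  have "1 / 2 \<noteq> real j" by (cases j) auto
  then show "wheel_hub \<noteq> parabola_point j" by (auto simp: wheel_hub_def parabola_point_def)
  then show "parabola_point j \<noteq> wheel_hub" by metis
qed

lemma wheel_not_collinear:
  assumes "i \<noteq> j"
  shows "\<not> collinear {wheel_hub, parabola_point i, parabola_point j}"
proof
  assume "collinear {wheel_hub, parabola_point i, parabola_point j}"
  from collinear_complex_cross[OF this]
  have "(real j - real i) * (4 * real i * real j - 2 * (real i + real j) + 3) = 0"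
    by (simp add: wheel_hub_def power2_eq_square field_simps)
  then have "4 * real i * real j - 2 * (real i + real j) + 3 = 0" using assms by simp
  \<comment> \<open>Passing to integers exposes the contradiction: the second factor is odd.\<close>
  then have "real_of_int (4 * int i * int j - 2 * (int i + int j) + 3) = real_of_int 0" by simp
  then have "4 * int i * int j - 2 * (int i + int j) + 3 = 0" by (simp only: of_int_eq_iff)
  moreover have "4 * p - 2 * (x + y) + 3 \<noteq> 0" for p x y :: int by presburger
  ultimately show False by (metis mult.assoc)
qed

text \<open>\<open>k + 1\<close> spokes and \<open>k + 1\<close> sides are the segments, and the hub
  with \<open>k + 1\<close> corners are the points, so \<open>2 * (k + 2) = (2 * k + 2) + 2\<close>
  is attained exactly.\<close>

lemma wheel_tight:
  assumes k: "2 \<le> k"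
  obtains M where "segment_halin_graph M" "card M = 2 * k + 2" "card (intersection_points M) = k + 2"
proof -
  let ?P = "parabola_point ` {..k}"
  define T where "T = (\<lambda>j. {wheel_hub, parabola_point j}) ` {..k}"
  define V where "V = ?P \<union> {wheel_hub}"
  \<comment> \<open>The index of a corner is recovered from its real part; around the hub the
    corners follow each other by index.\<close>
  define rot where "rot = (\<lambda>v u. if v = wheel_hub then parabola_point (Suc (nat \<lfloor>Re u\<rfloor>) mod Suc k) else u)"
  have T_cases: "(v = wheel_hub \<and> w \<in> ?P) \<or> (w = wheel_hub \<and> v \<in> ?P)" if vw: "{v, w} \<in> T" for v w
  proof -
    obtain j where "j \<le> k" "{v, w} = {wheel_hub, parabola_point j}" using vw unfolding T_def by blast
    then show ?thesis unfolding doubleton_eq_iff by blast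
  qed
  have T_edge: "{wheel_hub, parabola_point j} \<in> T" "{parabola_point j, wheel_hub} \<in> T" if "j \<le> k" for j
  proof -
    show "{wheel_hub, parabola_point j} \<in> T" using that unfolding T_def by blast
    then show "{parabola_point j, wheel_hub} \<in> T" by (simp add: insert_commute)
  qed
  have nbO: "neighbours T wheel_hub = ?P"
    using T_cases[of wheel_hub] T_edge unfolding neighbours_def by auto
  have nbP: "neighbours T (parabola_point j) = {wheel_hub}" if "j \<le> k" for j
    using T_cases[of "parabola_point j"] T_edge[OF that] unfolding neighbours_def by auto
  have cP: "card ?P = Suc k" by (simp add: card_image inj_on_def)
  have degO: "vdegree T wheel_hub = Suc k" by (simp add: vdegree_def nbO cP)
  have degP: "vdegree T (parabola_point j) = 1" if "j \<le> k" for j by (simp add: vdegree_def nbP that)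
  have leaves: "leaves V T = ?P" using k degO degP by (auto simp: leaves_def V_def)
  have conn: "connected_graph V T"
  proof (rule connected_graph_if_root[of wheel_hub])
    fix v assume "v \<in> V"
    then consider "v = wheel_hub" | "{wheel_hub, v} \<in> T" 
      using T_edge(1) by (auto simp: V_def)
    then show "(wheel_hub, v) \<in> {(x, y). {x, y} \<in> T}\<^sup>*" by cases auto
  qed (simp add: V_def)
  have acyc: "acyclic_graph T"
  proof (rule acyclic_graph_if_rank[of T "\<lambda>v. if v = wheel_hub then 0 else 1 :: nat"])
    fix v w w' assume H: "{v, w} \<in> T" "{v, w'} \<in> T"
      "(if w = wheel_hub then 0 else 1) \<le> (if v = wheel_hub then 0 else 1 :: nat)"
      "(if w' = wheel_hub then 0 else 1) \<le> (if v = wheel_hub then 0 else 1 :: nat)"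
    have "v \<noteq> wheel_hub" using T_cases[OF H(1)] H(3) by auto
    then show "w = w'" using T_cases[OF H(1)] T_cases[OF H(2)] by simp
  qed
  have sg: "simple_graph V T" by (auto simp: simple_graph_def V_def T_def)
  have pt: "plane_tree V T rot"
    unfolding plane_tree_def tree_graph_def
  proof (intro conjI ballI sg conn acyc)
    fix v assume "v \<in> V"
    then consider "v = wheel_hub" | j where "j \<le> k" "v = parabola_point j" by (auto simp: V_def)
    then show "cyclic_on (rot v) (neighbours T v)"
    proof cases
      case 1
      have "cyclic_on (rot wheel_hub) (parabola_point ` {..<Suc k})"
        by (rule cyclic_on_image_lessThan) (auto simp: rot_def)
      then show ?thesis using 1 nbO by (simp add: lessThan_Suc_atMost)
    next
      case 2
      then show ?thesis using nbP by (simp add: rot_def cyclic_on_singleton)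
    qed
  qed
  have cw: "clockwise_leaves V T rot (map parabola_point [0..<Suc k])"
  proof (rule clockwise_leaves_parabola_points[OF leaves])
    fix i assume i: "i \<le> k"
    then have "{parabola_point i, wheel_hub} \<in> T" by (rule T_edge)
    then have "contour T rot (parabola_point i) (parabola_point i) wheel_hub" by (rule contour.start)
    then have "contour T rot (parabola_point i) wheel_hub (rot wheel_hub (parabola_point i))"
      by (rule contour.turn) (use degO k in simp)
    then show "\<exists>u. contour T rot (parabola_point i) u (parabola_point (Suc i mod Suc k))"
      by (auto simp: rot_def)
  qed
  have "0 < edge_form k j wheel_hub" if "j \<le> k" for j
  proof -
    \<comment> \<open>This is the value at the hub of form \<open>j\<close> for
      \<open>j < k\<close>. For the chord the value is \<open>k / 2 - 3 / 4\<close>, positive since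
      \<open>2 \<le> k\<close>.\<close>
    have "0 < 1 / 4 + (real j)\<^sup>2" by (simp add: add_pos_nonneg)
    then show ?thesis using k by (simp add: edge_form_def wheel_hub_def power2_eq_square field_simps)
  qed
  then have I: "{wheel_hub} \<subseteq> interior (parabola_polygon k)" by (simp add: interior_parabola_polygon)
  have "wheel_hub \<notin> ?P" by auto
  then have cV: "card V = k + 2" using cP by (simp add: V_def)
  obtain M where M: "segment_halin_graph M" "card M = card V + k" "graph_vertices M = V"
  proof (rule segment_halin_graph_from_inscribed_tree[OF k I V_def _ _ _ pt _ _ cw])
    show "\<exists>u\<in>{wheel_hub}. \<exists>v\<in>V. e = {u, v}" if "e \<in> T" for e using that by (auto simp: T_def V_def)
    show "\<not> collinear {v, x, y}" if H: "{v, x} \<in> T" "{v, y} \<in> T" "x \<noteq> y" for v x y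
    proof (cases "v = wheel_hub")
      case True
      then obtain i j where "x = parabola_point i" "y = parabola_point j"
        using T_cases[OF H(1)] T_cases[OF H(2)] by auto
      then show ?thesis using True H(3) wheel_not_collinear by auto
    next
      case False
      then have "x = wheel_hub" "y = wheel_hub"
        using T_cases[OF H(1)] T_cases[OF H(2)] by auto
      then show ?thesis using H(3) by simp
    qed
    show "convex hull e \<inter> convex hull e' = {}" if "e \<in> T" "e' \<in> T" "e \<inter> e' = {}" for e e'
      using that by (auto simp: T_def)
    show "vdegree T v \<noteq> 2" if "v \<in> V" for v using that degO degP k by (auto simp: V_def)
    show "\<exists>v\<in>V. v \<notin> leaves V T" unfolding leaves by (intro bexI[of _ wheel_hub]) (auto simp: V_def)
  qed
  then show ?thesis using that[of M] segment_halin_graph_counts(1)[OF M(1)] cV by simp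
qed

text \<open>At the ends \<open>0\<close> and \<open>k\<close> the spine runs into the corners of the polygon.\<close>

definition spine_point :: "nat \<Rightarrow> nat \<Rightarrow> complex" where
  "spine_point k j = Complex (real j) ((real j)\<^sup>2 + (if 0 < j \<and> j < k then 1 else 0))"

lemma spine_point_sel [simp]:
  "Re (spine_point k j) = real j"
  "Im (spine_point k j) = (real j)\<^sup>2 + (if 0 < j \<and> j < k then 1 else 0)"
  by (simp_all add: spine_point_def)

lemma spine_point_eq_iff [simp]:
  "spine_point k i = spine_point k j \<longleftrightarrow> i = j"
  "spine_point k i = parabola_point j \<longleftrightarrow> i = j \<and> (i = 0 \<or> k \<le> i)"
  "parabola_point j = spine_point k i \<longleftrightarrow> i = j \<and> (i = 0 \<or> k \<le> i)"
  by (auto simp: complex_eq_iff)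

section \<open>Cubic caterpillars\<close>

lemma segment_Re_bounds:
  assumes "z \<in> closed_segment a b"
  shows "min (Re a) (Re b) \<le> Re z" "Re z \<le> max (Re a) (Re b)"
proof -
  have "Re z \<in> closed_segment (Re a) (Re b)"
    using assms closed_segment_linear_image[of Re a b] by (auto simp: bounded_linear.linear[OF bounded_linear_Re])
  then show "min (Re a) (Re b) \<le> Re z" "Re z \<le> max (Re a) (Re b)"
    by (auto simp: closed_segment_eq_real_ivl split: if_splits)
qed

text \<open>The bound \<open>3 \<le> k\<close> keeps the raised spine below the upper chord, whose
  form at \<open>q j\<close> is at least \<open>k - 2\<close>. For \<open>k = 2\<close> the spine
  would be straight.\<close>

locale caterpillar =
  fixes k :: nat
  assumes k: "3 \<le> k"
begin

abbreviation "p \<equiv> parabola_point"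
abbreviation "q \<equiv> spine_point k"

definition "I = q ` {0<..<k}"
definition "V = p ` {..k} \<union> I"
definition "T = (\<lambda>j. {q j, q (Suc j)}) ` {..<k} \<union> (\<lambda>j. {q j, p j}) ` {0<..<k}"

text \<open>The index of a vertex is read off its real part. At \<open>q j\<close> the cyclic order
  is \<open>q (j - 1)\<close>, \<open>p j\<close>, \<open>q (Suc j)\<close>, so the contour visits
  the corners by increasing index.\<close>

definition rot :: "complex \<Rightarrow> complex \<Rightarrow> complex" where
  "rot v u = (let j = nat \<lfloor>Re v\<rfloor> in
     if v = p j then u else if u = q (j - 1) then p j else if u = p j then q (Suc j) else q (j - 1))"

lemma p_eq_q: "p 0 = q 0" "p k = q k"
  by simp_all

lemma q_in_V: "j \<le> k \<Longrightarrow> q j \<in> V"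
proof -
  assume "j \<le> k"
  then consider "j = 0" | "j = k" | "0 < j" "j < k" by linarith
  then show ?thesis
  proof cases
    case 1
    then show ?thesis unfolding V_def by (auto simp flip: p_eq_q)
  next
    case 2
    then show ?thesis unfolding V_def by (auto simp flip: p_eq_q)
  next
    case 3
    then show ?thesis by (auto simp: V_def I_def)
  qed
qed

lemma V_cases:
  assumes "v \<in> V"
  obtains j where "j \<le> k" "v = p j" | j where "0 < j" "j < k" "v = q j"
  using assms unfolding V_def I_def by auto

lemma T_cases:
  assumes "e \<in> T"
  obtains j where "j < k" "e = {q j, q (Suc j)}" | j where "0 < j" "j < k" "e = {q j, p j}"
  using assms unfolding T_def by auto

lemma spine_edge: "j < k \<Longrightarrow> {q j, q (Suc j)} \<in> T" "j < k \<Longrightarrow> {q (Suc j), q j} \<in> T"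
proof -
  assume "j < k"
  then show "{q j, q (Suc j)} \<in> T" by (auto simp: T_def)
  then show "{q (Suc j), q j} \<in> T" by (simp add: insert_commute)
qed

lemma leg_edge: "0 < j \<Longrightarrow> j < k \<Longrightarrow> {q j, p j} \<in> T" "0 < j \<Longrightarrow> j < k \<Longrightarrow> {p j, q j} \<in> T"
proof -
  assume "0 < j" "j < k"
  then show "{q j, p j} \<in> T" by (auto simp: T_def)
  then show "{p j, q j} \<in> T" by (simp add: insert_commute)
qed

lemma edge_cases:
  assumes "{v, w} \<in> T"
  obtains j where "j < k" "v = q j" "w = q (Suc j)" | j where "j < k" "v = q (Suc j)" "w = q j"
    | j where "0 < j" "j < k" "v = q j" "w = p j" | j where "0 < j" "j < k" "v = p j" "w = q j"
  using T_cases[OF assms] by (metis doubleton_eq_iff)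

lemma neighbours_spine:
  assumes "0 < j" "j < k"
  shows "neighbours T (q j) = {q (j - 1), p j, q (Suc j)}"
proof
  show "neighbours T (q j) \<subseteq> {q (j - 1), p j, q (Suc j)}"
  proof
    fix w assume "w \<in> neighbours T (q j)"
    then have "{q j, w} \<in> T" by (simp add: neighbours_def)
    then show "w \<in> {q (j - 1), p j, q (Suc j)}" by (cases rule: edge_cases) (use assms in auto)
  qed
  obtain i where "j = Suc i" using assms by (cases j) auto
  then show "{q (j - 1), p j, q (Suc j)} \<subseteq> neighbours T (q j)"
    using assms spine_edge(1)[of j] spine_edge(2)[of i] leg_edge(1)[of j] by (auto simp: neighbours_def)
qed

lemma neighbours_leaf:
  assumes "j \<le> k"
  shows "neighbours T (p j) = {q (if j = 0 then 1 else if j = k then k - 1 else j)}" (is "_ = {?w}")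
proof
  show "neighbours T (p j) \<subseteq> {?w}"
  proof
    fix w assume "w \<in> neighbours T (p j)"
    then have "{p j, w} \<in> T" by (simp add: neighbours_def)
    then show "w \<in> {?w}" by (cases rule: edge_cases) (use assms k in auto)
  qed
  have "{p j, ?w} \<in> T"
  proof -
    consider "j = 0" | "j = k" | "0 < j" "j < k" using assms by linarith
    then show ?thesis
    proof cases
      case 1
      then show ?thesis using spine_edge(1)[of 0] k by (simp add: p_eq_q)
    next
      case 2
      then show ?thesis using spine_edge(2)[of "k - 1"] k by (simp add: p_eq_q)
    next
      case 3
      then show ?thesis using leg_edge(2)[of j] by simp
    qed
  qed
  then show "{?w} \<subseteq> neighbours T (p j)" by (simp add: neighbours_def)
qed

lemma vdegree_spine: "0 < j \<Longrightarrow> j < k \<Longrightarrow> vdegree T (q j) = 3"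
  by (cases j) (auto simp: vdegree_def neighbours_spine)

lemma vdegree_leaf: "j \<le> k \<Longrightarrow> vdegree T (p j) = 1"
  by (simp add: vdegree_def neighbours_leaf)

lemma leaves_eq: "leaves V T = p ` {..k}"
  using vdegree_spine vdegree_leaf unfolding leaves_def V_def I_def by auto

lemma rot_spine:
  assumes "0 < j" "j < k"
  shows "rot (q j) (q (j - 1)) = p j" "rot (q j) (p j) = q (Suc j)" "rot (q j) (q (Suc j)) = q (j - 1)"
  using assms by (auto simp: rot_def Let_def)

lemma rot_leaf: "rot (p j) u = u"
  by (simp add: rot_def)

lemma finite_V: "finite V"
  by (simp add: V_def I_def)

lemma p_in_V: "j \<le> k \<Longrightarrow> p j \<in> V"
  by (simp add: V_def)

lemma simple_graph: "simple_graph V T"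
  unfolding simple_graph_def
proof (intro conjI ballI finite_V)
  fix e assume "e \<in> T"
  then show "\<exists>u\<in>V. \<exists>v\<in>V. u \<noteq> v \<and> e = {u, v}"
  proof (cases rule: T_cases)
    case (1 j)
    then show ?thesis using q_in_V[of j] q_in_V[of "Suc j"]
      by (intro bexI[of _ "q j"] bexI[of _ "q (Suc j)"]) auto
  next
    case (2 j)
    then show ?thesis using q_in_V[of j] p_in_V[of j]
      by (intro bexI[of _ "q j"] bexI[of _ "p j"]) auto
  qed
qed

lemma connected: "connected_graph V T"
proof (rule connected_graph_if_root[of "q 0"])
  show "q 0 \<in> V" by (rule q_in_V) simp
  let ?r = "{(x, y). {x, y} \<in> T}"
  have spine: "(q 0, q j) \<in> ?r\<^sup>*" if "j \<le> k" for j
    using that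
  proof (induction j)
    case (Suc j)
    then have "(q 0, q j) \<in> ?r\<^sup>*" "(q j, q (Suc j)) \<in> ?r" using spine_edge(1)[of j] by auto
    then show ?case by (rule rtrancl_into_rtrancl)
  qed simp
  fix v assume "v \<in> V"
  then show "(q 0, v) \<in> ?r\<^sup>*"
  proof (cases rule: V_cases)
    case (1 j)
    consider "j = 0" | "j = k" | "0 < j" "j < k" using 1 by linarith
    then show ?thesis
    proof cases
      case 3
      then have "(q j, p j) \<in> ?r" using leg_edge(1) by simp
      then show ?thesis using spine[of j] 1 by (auto intro: rtrancl_into_rtrancl)
    qed (use 1 spine p_eq_q in auto)
  next
    case (2 j)
    then show ?thesis using spine by simp
  qed
qed

text \<open>The rank below orders the vertices as
  \<open>q 0 < q 1 < p 1 < q 2 < p 2 < \<dots> < q (k - 1) < p (k - 1) < q k\<close>.\<close>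

lemma acyclic: "acyclic_graph T"
proof (rule acyclic_graph_if_rank[of T "\<lambda>z. 2 * Re z + (Re z)\<^sup>2 - Im z"])
  \<comment> \<open>It takes the value \<open>2 * j\<close> at \<open>p j\<close> and
    \<open>2 * j - 1\<close> at a raised \<open>q j\<close>; thus each vertex except
    \<open>q 0\<close> has just one lower neighbour.\<close>
  let ?r = "\<lambda>z. 2 * Re z + (Re z)\<^sup>2 - Im z"
  have lower: "(\<exists>j<k. v = q (Suc j) \<and> w = q j) \<or> (\<exists>j. 0 < j \<and> j < k \<and> v = p j \<and> w = q j)"
    if vw: "{v, w} \<in> T" "?r w \<le> ?r v" for v w
    using vw(1)
  proof (cases rule: edge_cases)
    case (1 j)
    then show ?thesis using vw(2) by (auto split: if_splits)
  next
    case (3 j)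
    then show ?thesis using vw(2) by auto
  qed auto
  fix v w w' assume H: "{v, w} \<in> T" "{v, w'} \<in> T" "?r w \<le> ?r v" "?r w' \<le> ?r v"
  show "w = w'" using lower[OF H(1,3)] lower[OF H(2,4)] by auto
qed

lemma plane_tree: "plane_tree V T rot"
  unfolding plane_tree_def tree_graph_def
proof (intro conjI ballI simple_graph connected acyclic)
  fix v assume "v \<in> V"
  then show "cyclic_on (rot v) (neighbours T v)"
  proof (cases rule: V_cases)
    case (1 j)
    then show ?thesis by (simp add: neighbours_leaf rot_leaf cyclic_on_singleton)
  next
    case (2 j)
    then show ?thesis using rot_spine[of j] by (simp add: neighbours_spine cyclic_on_triple)
  qed
qed

text \<open>Coming from \<open>q (Suc j)\<close>, the walk leaves \<open>q j\<close> towards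
  \<open>q (j - 1)\<close>, since the legs all hang on the other side of the spine. From the last
  corner it therefore runs along the whole spine back to \<open>q 0 = p 0\<close>.\<close>

lemma contour_back:
  assumes "j < k"
  shows "contour T rot (p k) (q (Suc j)) (q j)"
proof -
  have "j \<le> k - 1" using assms by simp
  then show ?thesis
  proof (induction rule: inc_induct)
    case base
    have "{p k, q (k - 1)} \<in> T" using spine_edge(2)[of "k - 1"] k by (simp add: p_eq_q)
    then have "contour T rot (p k) (p k) (q (k - 1))" by (rule contour.start)
    then show ?case using k by (simp add: p_eq_q)
  next
    case (step n)
    have "contour T rot (p k) (q (Suc n)) (rot (q (Suc n)) (q (Suc (Suc n))))"
      using step vdegree_spine[of "Suc n"] by (intro contour.turn) auto
    then show ?case using rot_spine(3)[of "Suc n"] step by simp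
  qed
qed

lemma clockwise: "clockwise_leaves V T rot (map p [0..<Suc k])"
proof (rule clockwise_leaves_parabola_points[OF leaves_eq])
  fix i assume "i \<le> k"
  then consider "i = 0" | "i = k" | "0 < i" "i < k" by linarith
  then show "\<exists>u. contour T rot (p i) u (p (Suc i mod Suc k))"
  proof cases
    case 1
    have "contour T rot (p 0) (p 0) (q 1)"
      using spine_edge(1)[of 0] k by (intro contour.start) (simp add: p_eq_q)
    then have "contour T rot (p 0) (q 1) (rot (q 1) (p 0))"
      using vdegree_spine[of 1] k by (intro contour.turn) auto
    then have "contour T rot (p 0) (q 1) (p 1)" using rot_spine(1)[of 1] k by (simp add: p_eq_q)
    then show ?thesis using 1 k by auto
  next
    case 2
    have "contour T rot (p k) (q 1) (p 0)" using contour_back[of 0] k by (simp add: p_eq_q)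
    then show ?thesis using 2 by auto
  next
    case 3
    have "contour T rot (p i) (p i) (q i)" using leg_edge(2)[OF 3] by (rule contour.start)
    then have "contour T rot (p i) (q i) (rot (q i) (p i))"
      using vdegree_spine[OF 3] by (intro contour.turn) auto
    then have *: "contour T rot (p i) (q i) (q (Suc i))" using rot_spine(2)[OF 3] by simp
    show ?thesis
    \<comment> \<open>For \<open>Suc i = k\<close> the next spine point is already the corner
      \<open>p k\<close>; otherwise one more turn leads down its leg.\<close>
    proof (cases "Suc i = k")
      case True
      then have "contour T rot (p i) (q i) (p (Suc i))" using * by (simp add: p_eq_q)
      then show ?thesis using 3 by auto
    next
      case False
      then have "contour T rot (p i) (q (Suc i)) (rot (q (Suc i)) (q i))"
        using * 3 vdegree_spine[of "Suc i"] by (intro contour.turn) auto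
      then have "contour T rot (p i) (q (Suc i)) (p (Suc i))"
        using rot_spine(1)[of "Suc i"] 3 False by simp
      then show ?thesis using 3 by auto
    qed
  qed
qed

text \<open>With \<open>x = j - i\<close>, a form that equals \<open>x * (x - 1)\<close> at the
  corner becomes \<open>x\<^sup>2 - x + 1\<close> after raising by one, which has no real zero. At
  the chord, \<open>j * (k - j) \<ge> k - 1\<close> leaves room for the raise.\<close>

lemma edge_form_spine_pos:
  assumes "0 < j" "j < k" "i \<le> k"
  shows "0 < edge_form k i (q j)"
proof (cases "i < k")
  case True
  let ?x = "real j - real i"
  have "edge_form k i (q j) = (?x - 1 / 2)\<^sup>2 + 3 / 4"
    using True assms by (simp add: edge_form_def power2_eq_square field_simps)
  then show ?thesis by (simp add: add_nonneg_pos)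
next
  case False
  have "0 \<le> (real j - 1) * (real k - real j - 1)" using assms by (intro mult_nonneg_nonneg) auto
  then have "real k - 1 \<le> real k * real j - real j * real j" by (simp add: algebra_simps)
  then show ?thesis using False assms k by (simp add: edge_form_def power2_eq_square)
qed

lemma I_interior: "I \<subseteq> interior (parabola_polygon k)"
  unfolding I_def interior_parabola_polygon using edge_form_spine_pos by auto

text \<open>The second difference of the spine heights at \<open>q j\<close> is \<open>2\<close>,
  less one for each neighbour that is an unraised end of the spine. As \<open>3 \<le> k\<close>, at
  most one neighbour is, so the spine bends everywhere. Legs are vertical and spine edges are
  not.\<close>

lemma spine_not_collinear:
  assumes "0 < j" "j < k"
  shows "\<not> collinear {q j, q (j - 1), q (Suc j)}"
    "\<not> collinear {q j, q (j - 1), p j}" "\<not> collinear {q j, q (Suc j), p j}"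
proof -
  obtain i where i: "j = Suc i" using assms by (cases j) auto
  show "\<not> collinear {q j, q (j - 1), q (Suc j)}"
  proof
    assume "collinear {q j, q (j - 1), q (Suc j)}"
    from collinear_complex_cross[OF this] show False
      using assms i k by (auto simp: power2_eq_square algebra_simps split: if_splits)
  qed
  show "\<not> collinear {q j, q (j - 1), p j}"
  proof
    assume "collinear {q j, q (j - 1), p j}"
    from collinear_complex_cross[OF this] show False using assms i by simp
  qed
  show "\<not> collinear {q j, q (Suc j), p j}"
  proof
    assume "collinear {q j, q (Suc j), p j}"
    from collinear_complex_cross[OF this] show False using assms i by simp
  qed
qed

lemma adjacent_not_collinear:
  assumes H: "{v, x} \<in> T" "{v, y} \<in> T" "x \<noteq> y"
  shows "\<not> collinear {v, x, y}"
proof -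
  have xy: "x \<in> neighbours T v" "y \<in> neighbours T v" using H by (auto simp: neighbours_def)
  have "v \<in> V" using simple_graph_edgeD[OF simple_graph H(1)] by blast
  then show ?thesis
  proof (cases rule: V_cases)
    case (1 j)
    then show ?thesis using xy H(3) neighbours_leaf[of j] by auto
  next
    case (2 j)
    note nc = spine_not_collinear[OF 2(1,2)]
    have nc': "\<not> collinear {q j, q (Suc j), q (j - 1)}" "\<not> collinear {q j, p j, q (j - 1)}"
      "\<not> collinear {q j, p j, q (Suc j)}" using nc by (simp_all add: insert_commute)
    have "x \<in> {q (j - 1), p j, q (Suc j)}" "y \<in> {q (j - 1), p j, q (Suc j)}"
      using xy 2 neighbours_spine by auto
    then show ?thesis using H(3) nc nc' 2(3) by (elim insertE emptyE) simp_all
  qed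
qed

text \<open>A spine edge lies over an interval from \<open>j\<close> to \<open>j + 1\<close>, a leg
  over a single integer. A common point forces these indices to coincide or touch, and then the
  edges share a spine vertex.\<close>

lemma disjoint_edges:
  assumes H: "e \<in> T" "e' \<in> T" "e \<inter> e' = {}"
  shows "convex hull e \<inter> convex hull e' = {}"
proof (rule ccontr)
  assume "convex hull e \<inter> convex hull e' \<noteq> {}"
  then obtain z where z: "z \<in> convex hull e" "z \<in> convex hull e'" by blast
  have strip: "(\<exists>j<k. f = {q j, q (Suc j)} \<and> real j \<le> Re z \<and> Re z \<le> real (Suc j))
      \<or> (\<exists>j. f = {q j, p j} \<and> Re z = real j)" if f: "f \<in> T" "z \<in> convex hull f" for f
    using f(1)
  proof (cases rule: T_cases)
    case (1 j)
    then have "z \<in> closed_segment (q j) (q (Suc j))" using f(2) by (simp add: segment_convex_hull)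
    from segment_Re_bounds[OF this] show ?thesis using 1 by auto
  next
    case (2 j)
    then have "z \<in> closed_segment (q j) (p j)" using f(2) by (simp add: segment_convex_hull)
    from segment_Re_bounds[OF this] show ?thesis using 2 by auto
  qed
  show False
    using strip[OF H(1) z(1)]
  proof (elim disjE exE conjE)
    fix j assume j: "e = {q j, q (Suc j)}" "real j \<le> Re z" "Re z \<le> real (Suc j)"
    show False
      using strip[OF H(2) z(2)]
    proof (elim disjE exE conjE)
      fix i assume i: "e' = {q i, q (Suc i)}" "real i \<le> Re z" "Re z \<le> real (Suc i)"
      have "i \<le> Suc j" "j \<le> Suc i" using i j by linarith+
      then have "i = j \<or> i = Suc j \<or> j = Suc i" by linarith
      then show False using H(3) i(1) j(1) by auto
    next
      fix i assume i: "e' = {q i, p i}" "Re z = real i"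
      then have "i = j \<or> i = Suc j" using j by linarith
      then show False using H(3) i(1) j(1) by auto
    qed
  next
    fix j assume j: "e = {q j, p j}" "Re z = real j"
    show False
      using strip[OF H(2) z(2)]
    proof (elim disjE exE conjE)
      fix i assume i: "e' = {q i, q (Suc i)}" "real i \<le> Re z" "Re z \<le> real (Suc i)"
      then have "j = i \<or> j = Suc i" using j by linarith
      then show False using H(3) i(1) j(1) by auto
    next
      fix i assume i: "e' = {q i, p i}" "Re z = real i"
      then show False using H(3) i(1) j by auto
    qed
  qed
qed

lemma card_V: "card V = 2 * k"
proof -
  have "p ` {..k} \<inter> I = {}" by (auto simp: I_def)
  moreover have "card (p ` {..k}) = Suc k" "card I = k - 1"
    by (simp_all add: I_def card_image inj_on_def)
  ultimately show ?thesis using k by (simp add: V_def card_Un_disjoint I_def)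
qed

text \<open>With \<open>2 * k\<close> vertices and \<open>2 * k - 1\<close> tree edges plus
  \<open>k + 1\<close> sides, Euler's formula leaves \<open>k + 1\<close> circuits, exactly one
  third of \<open>3 * k + 3\<close>.\<close>

lemma tight: "\<exists>M. segment_halin_graph M \<and> card M = 3 * k \<and> card (circuits M) = k + 1"
proof -
  obtain M where M: "segment_halin_graph M" "card M = card V + k" "graph_vertices M = V"
    "card (graph_edges M) = card V + k"
  proof (rule segment_halin_graph_from_inscribed_tree[OF _ I_interior V_def _
        adjacent_not_collinear disjoint_edges plane_tree _ _ clockwise])
    show "2 \<le> k" using k by simp
    show "\<exists>u\<in>I. \<exists>v\<in>V. e = {u, v}" if "e \<in> T" for e
      using that
    proof (cases rule: T_cases)
      case (1 j)
      show ?thesis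
      \<comment> \<open>The first spine edge starts at the corner \<open>q 0\<close>, so its inner
        end is \<open>q 1\<close>.\<close>
      proof (cases "j = 0")
        case True
        have "q 1 \<in> I" using k by (simp add: I_def)
        moreover have "e = {q 1, q 0}" using 1 True by (simp add: insert_commute)
        ultimately show ?thesis using q_in_V[of 0] by blast
      next
        case False
        then have "q j \<in> I" using 1 by (simp add: I_def)
        then show ?thesis using 1 q_in_V[of "Suc j"] by auto
      qed
    next
      case (2 j)
      then have "q j \<in> I" "p j \<in> V" by (auto simp: I_def p_in_V)
      then show ?thesis using 2 by blast
    qed
    show "vdegree T v \<noteq> 2" if "v \<in> V" for v
      using that by (cases rule: V_cases) (simp_all add: vdegree_leaf vdegree_spine)
    have "q 1 \<in> V" "vdegree T (q 1) = 3" using q_in_V[of 1] vdegree_spine[of 1] k by auto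
    then show "\<exists>v\<in>V. v \<notin> leaves V T" by (intro bexI[of _ "q 1"]) (auto simp: leaves_def)
  qed
  have "card (circuits M) = k + 1" using segment_halin_graph_counts(2)[OF M(1)] M(3,4) by simp
  then show ?thesis using M card_V by auto
qed

end

theorem theorem1:
  shows "(\<forall>M. segment_halin_graph M \<longrightarrow>
            int (card (intersection_points M)) \<ge> \<lceil>(real (card M) + 2) / 2\<rceil>
            \<and> int (card (circuits M)) \<ge> \<lceil>(real (card M) + 3) / 3\<rceil>)
    \<and> infinite {m. \<exists>M. segment_halin_graph M \<and> card M = m
            \<and> int (card (intersection_points M)) = \<lceil>(real m + 2) / 2\<rceil>}
    \<and> infinite {m. \<exists>M. segment_halin_graph M \<and> card M = m
            \<and> int (card (circuits M)) = \<lceil>(real m + 3) / 3\<rceil>}"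
    (is "?bounds \<and> infinite ?A \<and> infinite ?B")
proof (intro conjI)
  show ?bounds
  proof (intro allI impI)
    fix M assume M: "segment_halin_graph M"
    note counts = segment_halin_graph_counts[OF M]
    \<comment> \<open>The ceilings cost nothing: the left-hand sides are integers, so the
      inequalities without rounding suffice.\<close>
    have "real (card M) + 2 \<le> 2 * real (card (intersection_points M))"
      using counts(3,4) unfolding counts(1) by linarith
    moreover have "real (card M) + 3 \<le> 3 * real (card (circuits M))"
      using counts(3,5) by linarith
    ultimately show "int (card (intersection_points M)) \<ge> \<lceil>(real (card M) + 2) / 2\<rceil>
        \<and> int (card (circuits M)) \<ge> \<lceil>(real (card M) + 3) / 3\<rceil>"
      by (simp add: ceiling_le_iff field_simps)
  qed
  have "2 * (k + 2) + 2 \<in> ?A" for k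
  proof -
    obtain M where "segment_halin_graph M" "card M = 2 * (k + 2) + 2"
      "card (intersection_points M) = (k + 2) + 2"
      using wheel_tight[of "k + 2"] by auto
    moreover have "(real (2 * (k + 2) + 2) + 2) / 2 = of_int (int ((k + 2) + 2))" by simp
    then have "\<lceil>(real (2 * (k + 2) + 2) + 2) / 2\<rceil> = int ((k + 2) + 2)" by (simp only: ceiling_of_int)
    ultimately show ?thesis by auto
  qed
  then have "range (\<lambda>k. 2 * (k + 2) + 2) \<subseteq> ?A" by blast
  moreover have "infinite (range (\<lambda>k :: nat. 2 * (k + 2) + 2))"
    by (rule range_inj_infinite) (simp add: inj_def)
  ultimately show "infinite ?A" by (rule infinite_super)
  have "3 * (k + 3) \<in> ?B" for k
  proof -
    interpret caterpillar "k + 3" by unfold_locales simp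
    obtain M where "segment_halin_graph M" "card M = 3 * (k + 3)" "card (circuits M) = (k + 3) + 1"
      using tight by blast
    moreover have "(real (3 * (k + 3)) + 3) / 3 = of_int (int ((k + 3) + 1))" by simp
    then have "\<lceil>(real (3 * (k + 3)) + 3) / 3\<rceil> = int ((k + 3) + 1)" by (simp only: ceiling_of_int)
    ultimately show ?thesis by auto
  qed
  then have "range (\<lambda>k. 3 * (k + 3)) \<subseteq> ?B" by blast
  moreover have "infinite (range (\<lambda>k :: nat. 3 * (k + 3)))"
    by (rule range_inj_infinite) (simp add: inj_def)
  ultimately show "infinite ?B" by (rule infinite_super)
qed

end
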